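(* There exist absolute constants $C_1,C_2,C_3,C_4,c_1,c_2,c_3>0$ such that the following holds. Let $\epsilon\in(0,1/2)$, let $\delta>0$ satisfy $\epsilon/\delta\ge C_1$, and let the dimension $p\ge3$ satisfy $p\ge C_2\left((\epsilon/\delta)\log p\right)^{C_3}$. Then any statistical query algorithm that solves linear regression under the adaptive response contamination model (in dimension $p$ with contamination rate $\epsilon$) with error $\delta$, $k$ queries and tolerance $\tau$ must satisfy either - (large number of queries) $k\ge 2^{c_1p^{c_2}}$, or - (small tolerance) $\tau\le C_4\,p^{-c_3\epsilon^2/\delta^2}$.
   Context: Model class: $\mathcal{D}_{\beta,\sigma,\epsilon}$ is the set of all distributions of $(X,y)\in\mathbb{R}^p\times\mathbb{R}$ such that $X\sim\mathcal{N}(0,I_p)$ and $y\mid X\sim(1-\epsilon)\mathcal{N}(X^\top\beta,\sigma^2)+\epsilon Q_X$ for some arbitrary conditional distribution $Q_x$ on $\mathbb{R}$ depending on $x$ (adaptive response contamination model). Statistical queries: let $\mathcal{F}$ be the set of measurable functions $q$ from the domain to $[-1,1]$. For a distribution $P$ and tolerance $\tau\in(0,1)$, $\mathtt{Oracle}_{P,\tau}$ is the set of all maps $g:\mathcal{F}\to\mathbb{R}$ with $|g(q)-\mathbb{E}_P[q]|\le\tau$ for every $q\in\mathcal{F}$. An SQ algorithm $\mathcal{A}\in\mathrm{SQ}(k,\tau)$ interacts with an unknown oracle $\mathtt{STAT}_{P,\tau}\in\mathtt{Oracle}_{P,\tau}$ in $k$ rounds: in round $i$ it (possibly randomly) chooses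 $q_i\in\mathcal{F}$ based on the history $(q_j,v_j)_{j<i}$ and receives $v_i=\mathtt{STAT}_{P,\tau}(q_i)$; after $k$ rounds it outputs a value $\mathcal{A}(\mathtt{STAT}_{P,\tau})$ (here in $\mathbb{R}^p$). $\mathcal{A}$ solves linear regression under the model with error $\delta$, $k$ queries and tolerance $\tau$ if $\mathcal{A}\in\mathrm{SQ}(k,\tau)$ and $$\sup_{(\beta,\sigma):\|\beta\|_2\le1,\ \sigma\in[1/2,1]}\ \sup_{P\in\mathcal{D}_{\beta,\sigma,\epsilon}}\ \sup_{\mathtt{STAT}_{P,\tau}\in\mathtt{Oracle}_{P,\tau}}\mathbb{P}\left(\|\mathcal{A}(\mathtt{STAT}_{P,\tau})-\beta\|_2>\sigma\delta\right)\le0.1,$$ the probability being over the randomness of the algorithm. *)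

theory Defs
  imports "HOL-Probability.Probability"
begin

text \<open>
  The dimension p is quantified under absolute constants, so it is a natural number rather than an
  index type: a vector in R^p is a function on \<^term>\<open>{..<p}\<close>, undefined outside, and the Borel
  structure of R^p is the product one.
\<close>

type_synonym rvec = "nat \<Rightarrow> real"
type_synonym query = "rvec \<times> real \<Rightarrow> real"
type_synonym history = "(query \<times> real) list"

definition vec_borel :: "nat \<Rightarrow> rvec measure" where
  "vec_borel p = (\<Pi>\<^sub>M i\<in>{..<p}. borel)"

definition dot :: "nat \<Rightarrow> rvec \<Rightarrow> rvec \<Rightarrow> real" where
  "dot p x y = (\<Sum>i<p. x i * y i)"

definition norm2 :: "nat \<Rightarrow> rvec \<Rightarrow> real" where
  "norm2 p x = L2_set x {..<p}"

definition sample_space :: "nat \<Rightarrow> (rvec \<times> real) measure" where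
  "sample_space p = vec_borel p \<Otimes>\<^sub>M borel"

definition normal_measure :: "real \<Rightarrow> real \<Rightarrow> real measure" where
  "normal_measure m s = density lborel (\<lambda>y. ennreal (normal_density m s y))"

definition gaussian_vec :: "nat \<Rightarrow> rvec measure" where
  "gaussian_vec p = (\<Pi>\<^sub>M i\<in>{..<p}. normal_measure 0 1)"

text \<open>
  The joint law of (X, y) is given by its disintegration along X: the standard Gaussian law for X,
  and given X = x the mixture of N(dot x b, s^2) and Q x, where Q is an arbitrary Markov kernel.
  Note that \<^term>\<open>normal_density\<close> takes the standard deviation, not the variance.
\<close>

definition contaminated_model :: "nat \<Rightarrow> rvec \<Rightarrow> real \<Rightarrow> real \<Rightarrow> (rvec \<times> real) measure set" where
  "contaminated_model p b s eps =
     {P. sets P = sets (sample_space p) \<and>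
         (\<exists>Q \<in> vec_borel p \<rightarrow>\<^sub>M prob_algebra borel.
            \<forall>A \<in> sets (sample_space p).
              emeasure P A =
                (\<integral>\<^sup>+ x. (ennreal (1 - eps) * emeasure (normal_measure (dot p x b) s) {y. (x, y) \<in> A}
                     + ennreal eps * emeasure (Q x) {y. (x, y) \<in> A}) \<partial>gaussian_vec p))}"

text \<open>
  Queries are undefined outside the sample space, so that an oracle cannot tell apart two
  representations of the same function on the domain.
\<close>

definition queries :: "nat \<Rightarrow> query set" where
  "queries p = borel_measurable (sample_space p) \<inter> (space (sample_space p) \<rightarrow>\<^sub>E {-1..1})"

definition oracles :: "nat \<Rightarrow> (rvec \<times> real) measure \<Rightarrow> real \<Rightarrow> (query \<Rightarrow> real) set" where
  "oracles p P \<tau> = {g. \<forall>q \<in> queries p. \<bar>g q - (\<integral>z. q z \<partial>P)\<bar> \<le> \<tau>}"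

datatype sq_strategy = SQ_Strategy (ask: "history \<Rightarrow> query") (answer: "history \<Rightarrow> rvec")

definition strategies :: "nat \<Rightarrow> nat \<Rightarrow> sq_strategy set" where
  "strategies p k =
     {S. (\<forall>h. length h < k \<and> set h \<subseteq> queries p \<times> UNIV \<longrightarrow> ask S h \<in> queries p) \<and>
         (\<forall>h. length h = k \<and> set h \<subseteq> queries p \<times> UNIV \<longrightarrow> answer S h \<in> space (vec_borel p))}"

primrec transcript :: "sq_strategy \<Rightarrow> (query \<Rightarrow> real) \<Rightarrow> nat \<Rightarrow> history" where
  "transcript S g 0 = []"
| "transcript S g (Suc i) =
     (let h = transcript S g i; q = ask S h in h @ [(q, g q)])"

definition sq_output :: "nat \<Rightarrow> (query \<Rightarrow> real) \<Rightarrow> sq_strategy \<Rightarrow> rvec" where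
  "sq_output k g S = answer S (transcript S g k)"

text \<open>
  A randomized algorithm is a probability measure on deterministic strategies, on an arbitrary
  sigma-algebra.  This loses no generality: an algorithm that draws an internal seed (at once or
  round by round) from some probability space, and is deterministic given the seed, is the
  push-forward of the seed distribution under the map from seeds to strategies.
\<close>

definition sq_algorithms :: "nat \<Rightarrow> nat \<Rightarrow> sq_strategy measure set" where
  "sq_algorithms p k = {M. prob_space M \<and> space M \<subseteq> strategies p k}"

text \<open>
  The failure event is explicitly required to be measurable, because \<^term>\<open>measure M\<close> is 0 on
  non-measurable sets.
\<close>

definition solves_regression ::
  "nat \<Rightarrow> real \<Rightarrow> real \<Rightarrow> nat \<Rightarrow> real \<Rightarrow> sq_strategy measure \<Rightarrow> bool" where
  "solves_regression p eps \<delta> k \<tau> M \<longleftrightarrow>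
     M \<in> sq_algorithms p k \<and>
     (\<forall>b \<in> space (vec_borel p). \<forall>s \<in> {1/2..1}. norm2 p b \<le> 1 \<longrightarrow>
       (\<forall>P \<in> contaminated_model p b s eps. \<forall>g \<in> oracles p P \<tau>.
         let failure = {S \<in> space M. norm2 p (\<lambda>i. sq_output k g S i - b i) > s * \<delta>}
         in failure \<in> sets M \<and> measure M failure \<le> 0.1))"

end

theory Submission
  imports Defs
begin

text \<open>
  The hidden regression vector is \<open>b = \<kappa> v\<close> with \<open>\<kappa> = 3 \<delta>\<close>, \<open>\<sigma> = 1\<close> and \<open>v\<close> the normalized indicator of a set
  \<open>A\<close>, where \<open>A\<close> ranges over a huge family of sets with small pairwise intersections.  Write \<open>t\<close> for the
  coordinate of \<open>X\<close> along \<open>v\<close> and \<open>T\<close> for a constant multiple of \<open>\<epsilon> / \<delta>\<close>.  As long as \<open>\<bar>t\<bar> \<le> T\<close>, the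
  contamination can hide the shift by \<open>\<kappa> t\<close> completely, making \<open>y\<close> independent of \<open>t\<close>.  The remaining
  dependence, coming from \<open>\<bar>t\<bar> > T\<close>, is of relative size \<open>exp (- c T\<^sup>2)\<close>; by Lagrange extrapolation the slack
  of the contamination inside \<open>[-T, T]\<close> suffices to cancel its moments in \<open>t\<close> up to a degree \<open>m\<close> of order
  \<open>T\<^sup>2\<close>, for every value of \<open>y\<close>.  The resulting laws have the form \<open>(1 + f_A) dP\<^sub>0\<close> with a product
  measure \<open>P\<^sub>0\<close>, and the matched moments make the correlation of \<open>f_A\<close> and \<open>f_B\<close> exponentially small in
  \<open>m\<close>: it is at most \<open>(C |A \<inter> B| / |A|) ^ (m / 2)\<close>.  Hence a query can tell only few members of the family
  from \<open>P\<^sub>0\<close>, and an oracle that answers as under \<open>P\<^sub>0\<close> whenever it may defeats every algorithm with few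
  queries.
\<close>

section \<open>Transcripts and query counting\<close>

text \<open>The contamination must stay a density at every response, so all corrections have to fit
  into \<open>eps\<close> times the widened Gaussian, a budget split in two halves. Hiding a shift
  of at most \<open>\<kappa> * T = eps / 6\<close> uses one half; the other pays for the moment
  correction. Extrapolating m moments from [0, T / 4) to a point beyond T costs a factor exp (5 (m +
  1)), apart from growth in the point itself, while the Gaussian weight out there still gains exp (-
  7 T^2 / 32). The condition \<open>64 * (m + 1) \<le> T\<^sup>2\<close> balances the two, which is
  why m is of order T^2. A correction sitting on finitely many interpolation nodes would have no
  density relative to the law of X; averaging over translated nodes spreads it out. Sets of size t^2
  with overlaps below t, for t about p^(1/6), make the base of the correlation decay a constant
  multiple of p^(-1/6). The exponent is of order T^2, that is (eps / \<delta>)^2, and this is the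
  source of the exponent in the tolerance.\<close>

lemma transcript_props:
  assumes "S \<in> strategies p k" "i \<le> k"
  shows "length (transcript S g i) = i \<and> set (transcript S g i) \<subseteq> queries p \<times> UNIV"
  using assms(2)
proof (induction i)
  case (Suc i)
  then have IH: "length (transcript S g i) = i" "set (transcript S g i) \<subseteq> queries p \<times> UNIV"
    by auto
  with Suc.prems assms(1) have "ask S (transcript S g i) \<in> queries p"
    by (auto simp: strategies_def)
  with IH show ?case by (simp add: Let_def)
qed simp

text \<open>Agreement is required only on the queries that the run against \<open>g\<close> really
  asks, so an adversarial oracle may answer all other queries differently.\<close>

lemma transcript_cong:
  assumes "\<And>i. i < k \<Longrightarrow> g' (ask S (transcript S g i)) = g (ask S (transcript S g i))" "i \<le> k"
  shows "transcript S g' i = transcript S g i"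
  using assms(2) by (induction i) (simp_all add: Let_def assms(1))

lemma norm2_triangle_diff:
  "norm2 p (\<lambda>i. b i - b' i) \<le> norm2 p (\<lambda>i. x i - b i) + norm2 p (\<lambda>i. x i - b' i)"
proof -
  have "norm2 p (\<lambda>i. b i - b' i) = L2_set (\<lambda>i. (x i - b' i) + (b i - x i)) {..<p}"
    unfolding norm2_def by (simp add: algebra_simps)
  also have "\<dots> \<le> L2_set (\<lambda>i. x i - b' i) {..<p} + L2_set (\<lambda>i. b i - x i) {..<p}"
    by (rule L2_set_triangle_ineq)
  also have "L2_set (\<lambda>i. b i - x i) {..<p} = L2_set (\<lambda>i. x i - b i) {..<p}"
    unfolding L2_set_def by (simp add: power2_commute)
  finally show ?thesis by (simp add: norm2_def)
qed

text \<open>Fix a deterministic strategy and run it on the answers \<open>E\<close>. If none of its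
  k queries separates v from \<open>E\<close>, then the oracle \<open>g v\<close> reproduces this
  run, so all such v share one output, and by \<open>sep\<close> that output is within \<delta> of
  at most one \<open>b v\<close>. Every other v on which the strategy succeeds is exposed by one of
  the k queries, and each query exposes at most K of them. Averaging over the random strategy turns
  failure probability 0.1 into the factor 0.9.\<close>

lemma solvers_need_many_queries:
  fixes V :: "'v set" and b :: "'v \<Rightarrow> rvec" and P :: "'v \<Rightarrow> (rvec \<times> real) measure"
  assumes sol: "solves_regression p eps \<delta> k \<tau> M"
    and \<tau>: "\<tau> \<ge> 0"
    and V: "finite V"
    and b: "\<And>v. v \<in> V \<Longrightarrow> b v \<in> space (vec_borel p)" "\<And>v. v \<in> V \<Longrightarrow> norm2 p (b v) \<le> 1"
    and sep: "\<And>v w. v \<in> V \<Longrightarrow> w \<in> V \<Longrightarrow> v \<noteq> w \<Longrightarrow> norm2 p (\<lambda>i. b v i - b w i) > 2 * \<delta>"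
    and P: "\<And>v. v \<in> V \<Longrightarrow> P v \<in> contaminated_model p (b v) 1 eps"
    and K: "\<And>q. q \<in> queries p \<Longrightarrow>
              real (card {v \<in> V. \<bar>E q - (\<integral>z. q z \<partial>P v)\<bar> > \<tau>}) \<le> K"
  shows "0.9 * real (card V) \<le> 1 + real k * K"
proof -
  define g where "g v q = (if \<bar>E q - (\<integral>z. q z \<partial>P v)\<bar> \<le> \<tau> then E q else (\<integral>z. q z \<partial>P v))" for v q
  define fl where "fl v = {S \<in> space M. norm2 p (\<lambda>i. sq_output k (g v) S i - b v i) > 1 * \<delta>}" for v
  have g: "g v \<in> oracles p (P v) \<tau>" for v
    using \<tau> by (auto simp: oracles_def g_def)
  have M: "prob_space M" "space M \<subseteq> strategies p k"
    using sol by (auto simp: solves_regression_def sq_algorithms_def)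
  interpret prob_space M by fact
  have fl: "fl v \<in> sets M \<and> measure M (fl v) \<le> 0.1" if "v \<in> V" for v
  proof -
    have "\<forall>b \<in> space (vec_borel p). \<forall>s \<in> {1/2..1}. norm2 p b \<le> 1 \<longrightarrow>
       (\<forall>P \<in> contaminated_model p b s eps. \<forall>g \<in> oracles p P \<tau>.
         {S \<in> space M. norm2 p (\<lambda>i. sq_output k g S i - b i) > s * \<delta>} \<in> sets M \<and>
         measure M {S \<in> space M. norm2 p (\<lambda>i. sq_output k g S i - b i) > s * \<delta>} \<le> 0.1)"
      using sol unfolding solves_regression_def Let_def by blast
    from bspec[OF this b(1)[OF that], THEN bspec, of 1] b(2)[OF that] P[OF that] g[of v]
    show ?thesis unfolding fl_def by auto
  qed
  have few: "real (card {v \<in> V. S \<notin> fl v}) \<le> 1 + real k * K" if S: "S \<in> space M" for S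
  proof -
    let ?q = "\<lambda>i. ask S (transcript S E i)"
    let ?bad = "\<lambda>q. {v \<in> V. \<bar>E q - (\<integral>z. q z \<partial>P v)\<bar> > \<tau>}"
    let ?c = "{v \<in> V. norm2 p (\<lambda>i. sq_output k E S i - b v i) \<le> \<delta>}"
    have q: "?q i \<in> queries p" if "i < k" for i
      using transcript_props[of S p k i E] S M(2) that by (auto simp: strategies_def)
    have sub: "{v \<in> V. S \<notin> fl v} \<subseteq> ?c \<union> (\<Union>i<k. ?bad (?q i))"
    proof
      fix v assume v: "v \<in> {v \<in> V. S \<notin> fl v}"
      show "v \<in> ?c \<union> (\<Union>i<k. ?bad (?q i))"
      proof (cases "v \<in> (\<Union>i<k. ?bad (?q i))")
        case False
        then have "g v (?q i) = E (?q i)" if "i < k" for i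
          using v that by (auto simp: g_def not_less)
        then have "transcript S (g v) k = transcript S E k"
          by (intro transcript_cong[where k = k]) simp_all
        with v S show ?thesis by (auto simp: fl_def sq_output_def)
      qed auto
    qed
    have "v = w" if "v \<in> ?c" "w \<in> ?c" for v w
      using sep[of v w] norm2_triangle_diff[of p "b v" "b w" "sq_output k E S"] that
      by (cases "v = w") auto
    then have c1: "card ?c \<le> 1"
      by (metis (no_types, lifting) V card_le_Suc0_iff_eq One_nat_def finite_subset mem_Collect_eq subsetI)
    have "card {v \<in> V. S \<notin> fl v} \<le> card (?c \<union> (\<Union>i<k. ?bad (?q i)))"
      using V by (intro card_mono sub) auto
    also have "\<dots> \<le> card ?c + card (\<Union>i<k. ?bad (?q i))"
      by (rule card_Un_le)
    also have "\<dots> \<le> 1 + (\<Sum>i<k. card (?bad (?q i)))"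
      using c1 card_UN_le[of "{..<k}" "\<lambda>i. ?bad (?q i)"] by auto
    finally have "real (card {v \<in> V. S \<notin> fl v}) \<le> 1 + (\<Sum>i<k. real (card (?bad (?q i))))"
      by (simp flip: of_nat_sum of_nat_Suc)
    also have "\<dots> \<le> 1 + (\<Sum>i<k. K)"
      using K q by (intro add_left_mono sum_mono) auto
    finally show ?thesis by simp
  qed
  have "0.9 * real (card V) = (\<Sum>v\<in>V. 0.9)" by simp
  also have "\<dots> \<le> (\<Sum>v\<in>V. prob (space M - fl v))"
    using fl by (intro sum_mono) (fastforce simp: prob_compl)
  also have "\<dots> = (\<Sum>v\<in>V. expectation (indicator (space M - fl v)))"
    using fl by (intro sum.cong) (auto simp: Int_absorb2 sets.sets_into_space)
  also have "\<dots> = expectation (\<lambda>S. \<Sum>v\<in>V. indicator (space M - fl v) S)"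
    using fl by (intro Bochner_Integration.integral_sum[symmetric]) (auto intro!: integrable_real_indicator simp: emeasure_eq_measure)
  also have "\<dots> \<le> expectation (\<lambda>S. 1 + real k * K)"
  proof (rule integral_mono)
    show "integrable M (\<lambda>S. \<Sum>v\<in>V. indicator (space M - fl v) S :: real)"
      using fl by (intro Bochner_Integration.integrable_sum) (auto intro!: integrable_real_indicator simp: emeasure_eq_measure)
    fix S assume S: "S \<in> space M"
    have "(\<Sum>v\<in>V. indicator (space M - fl v) S :: real) = (\<Sum>v\<in>V. if S \<notin> fl v then 1 else 0)"
      using S by (intro sum.cong) (auto simp: indicator_def)
    also have "\<dots> = real (card {v \<in> V. S \<notin> fl v})"
      using V by (simp add: sum.If_cases Int_def)
    finally show "(\<Sum>v\<in>V. indicator (space M - fl v) S) \<le> 1 + real k * K"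
      using few[OF S] by simp
  qed simp
  finally show ?thesis by (simp add: prob_space)
qed

section \<open>Set families with small intersections\<close>

lemma card_subsets_containing:
  assumes "finite U" "C \<subseteq> U" "card C \<le> n"
  shows "card {B. B \<subseteq> U \<and> card B = n \<and> C \<subseteq> B} = (card U - card C) choose (n - card C)"
proof -
  have fC: "finite C" using assms finite_subset by auto
  have "bij_betw (\<lambda>B. B - C) {B. B \<subseteq> U \<and> card B = n \<and> C \<subseteq> B} {B. B \<subseteq> U - C \<and> card B = n - card C}"
  proof (rule bij_betwI[where g = "\<lambda>B. B \<union> C"])
    show "(\<lambda>B. B - C) \<in> {B. B \<subseteq> U \<and> card B = n \<and> C \<subseteq> B} \<rightarrow> {B. B \<subseteq> U - C \<and> card B = n - card C}"
      using fC by (auto simp: card_Diff_subset)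
    show "(\<lambda>B. B \<union> C) \<in> {B. B \<subseteq> U - C \<and> card B = n - card C} \<rightarrow> {B. B \<subseteq> U \<and> card B = n \<and> C \<subseteq> B}"
    proof safe
      fix B assume B: "B \<subseteq> U - C" "card B = n - card C"
      have "card (B \<union> C) = card B + card C"
        using B fC assms(1) by (intro card_Un_disjoint) (auto intro: finite_subset)
      with B assms(3) show "card (B \<union> C) = n" by simp
    qed (use assms in auto)
  qed auto
  then have "card {B. B \<subseteq> U \<and> card B = n \<and> C \<subseteq> B} = card {B. B \<subseteq> U - C \<and> card B = n - card C}"
    by (rule bij_betw_same_card)
  also have "\<dots> = card (U - C) choose (n - card C)"
    using assms by (intro n_subsets) auto
  finally show ?thesis using assms fC by (simp add: card_Diff_subset)
qed

text \<open>Greedy (Gilbert--Varshamov) choice: a maximal family covers all \<open>n\<close>-subsets by its neighbourhoods.\<close>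

lemma nearly_disjoint_subsets:
  fixes p n t :: nat
  assumes tn: "t \<le> n" and np: "n \<le> p"
  obtains \<A> where "\<A> \<subseteq> {A. A \<subseteq> {..<p} \<and> card A = n}"
    "\<And>A B. A \<in> \<A> \<Longrightarrow> B \<in> \<A> \<Longrightarrow> A \<noteq> B \<Longrightarrow> card (A \<inter> B) < t"
    "p choose t \<le> card \<A> * (n choose t)\<^sup>2"
proof -
  define \<U> where "\<U> = {A. A \<subseteq> {..<p} \<and> card A = n}"
  have fU: "finite \<U>" by (auto simp: \<U>_def)
  define good where "good \<A> \<longleftrightarrow> (\<forall>A\<in>\<A>. \<forall>B\<in>\<A>. A \<noteq> B \<longrightarrow> card (A \<inter> B) < t)" for \<A> :: "nat set set"
  have "finite {\<A>. \<A> \<subseteq> \<U> \<and> good \<A>}"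
    using fU by auto
  moreover have "{} \<in> {\<A>. \<A> \<subseteq> \<U> \<and> good \<A>}" by (auto simp: good_def)
  ultimately have "\<exists>\<A>\<in>{\<A>. \<A> \<subseteq> \<U> \<and> good \<A>}. \<forall>\<B>\<in>{\<A>. \<A> \<subseteq> \<U> \<and> good \<A>}. \<A> \<subseteq> \<B> \<longrightarrow> \<A> = \<B>"
    by (intro finite_has_maximal) auto
  then obtain \<A> where A: "\<A> \<in> {\<A>. \<A> \<subseteq> \<U> \<and> good \<A>}"
    and mx: "\<And>\<B>. \<B> \<in> {\<A>. \<A> \<subseteq> \<U> \<and> good \<A>} \<Longrightarrow> \<A> \<subseteq> \<B> \<Longrightarrow> \<A> = \<B>"
    by metis
  have fA: "finite \<A>" using A fU finite_subset by auto
  define N where "N A = {B \<in> \<U>. t \<le> card (A \<inter> B)}" for A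
  have cov: "\<U> \<subseteq> (\<Union>A\<in>\<A>. N A)"
  proof
    fix B assume B: "B \<in> \<U>"
    show "B \<in> (\<Union>A\<in>\<A>. N A)"
    proof (rule ccontr)
      assume "B \<notin> (\<Union>A\<in>\<A>. N A)"
      then have *: "card (A \<inter> B) < t" if "A \<in> \<A>" for A
        using that B by (auto simp: N_def not_le)
      then have "good (insert B \<A>)"
        using A by (auto simp: good_def Int_commute)
      with A B have "\<A> = insert B \<A>" by (intro mx) auto
      then have "B \<in> \<A>" by auto
      from *[OF this] B tn show False by (auto simp: \<U>_def)
    qed
  qed
  have N: "card (N A) \<le> (n choose t) * ((p - t) choose (n - t))" if "A \<in> \<A>" for A
  proof -
    have A': "A \<subseteq> {..<p}" "card A = n" "finite A"
      using A that by (auto simp: \<U>_def intro: finite_subset)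
    let ?Cs = "{C. C \<subseteq> A \<and> card C = t}"
    have "N A \<subseteq> (\<Union>C\<in>?Cs. {B. B \<subseteq> {..<p} \<and> card B = n \<and> C \<subseteq> B})"
    proof
      fix B assume "B \<in> N A"
      moreover then obtain C where "C \<subseteq> A \<inter> B" "card C = t"
        by (metis (no_types, lifting) N_def mem_Collect_eq obtain_subset_with_card_n)
      ultimately show "B \<in> (\<Union>C\<in>?Cs. {B. B \<subseteq> {..<p} \<and> card B = n \<and> C \<subseteq> B})"
        by (auto simp: N_def \<U>_def)
    qed
    then have "card (N A) \<le> card (\<Union>C\<in>?Cs. {B. B \<subseteq> {..<p} \<and> card B = n \<and> C \<subseteq> B})"
      using A'(3) by (intro card_mono) (auto intro!: finite_UN_I)
    also have "\<dots> \<le> (\<Sum>C\<in>?Cs. card {B. B \<subseteq> {..<p} \<and> card B = n \<and> C \<subseteq> B})"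
      using A'(3) by (intro card_UN_le) auto
    also have "\<dots> = (\<Sum>C\<in>?Cs. (p - t) choose (n - t))"
    proof (rule sum.cong[OF refl])
      fix C assume "C \<in> ?Cs"
      then show "card {B. B \<subseteq> {..<p} \<and> card B = n \<and> C \<subseteq> B} = (p - t) choose (n - t)"
        using card_subsets_containing[of "{..<p}" C n] A' tn by auto
    qed
    also have "\<dots> = (n choose t) * ((p - t) choose (n - t))"
      using n_subsets[OF A'(3), of t] A' by simp
    finally show ?thesis .
  qed
  have "p choose n = card \<U>"
    using n_subsets[of "{..<p}" n] by (simp add: \<U>_def)
  also have "\<dots> \<le> card (\<Union>A\<in>\<A>. N A)"
    using fA fU by (intro card_mono cov) (auto simp: N_def)
  also have "\<dots> \<le> (\<Sum>A\<in>\<A>. card (N A))"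
    using fA by (rule card_UN_le)
  also have "\<dots> \<le> card \<A> * ((n choose t) * ((p - t) choose (n - t)))"
    using sum_bounded_above[of \<A> "\<lambda>A. card (N A)"] N by simp
  \<comment> \<open>The extra factor prepares the identity (p choose n)(n choose t) = (p choose t)(p
    - t choose n - t), after which the second factor cancels and n survives only in n choose
    t.\<close>
  finally have "(p choose n) * (n choose t) \<le> card \<A> * ((n choose t) * ((p - t) choose (n - t))) * (n choose t)"
    by (rule mult_right_mono) simp
  then have "(p choose t) * ((p - t) choose (n - t)) \<le> (card \<A> * (n choose t)\<^sup>2) * ((p - t) choose (n - t))"
    unfolding choose_mult[OF tn np] by (simp only: power2_eq_square mult_ac)
  moreover have "(p - t) choose (n - t) > 0" using np tn by (intro zero_less_binomial) auto
  ultimately have "p choose t \<le> card \<A> * (n choose t)\<^sup>2" by simp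
  with A show ?thesis by (intro that[of \<A>]) (auto simp: good_def \<U>_def)
qed

text \<open>Size t^2 makes every overlap less than a fraction 1 / t of the set. The count balances
  (p / t)^t, at least t^(5 t) because p is at least t^6, against the square of (t^2 choose t), at
  most t^(4 t).\<close>

lemma many_nearly_disjoint_subsets:
  fixes p t :: nat
  assumes t: "t > 0" and p: "t ^ 6 \<le> p"
  obtains \<A> where "\<A> \<subseteq> {A. A \<subseteq> {..<p} \<and> card A = t\<^sup>2}"
    "\<And>A B. A \<in> \<A> \<Longrightarrow> B \<in> \<A> \<Longrightarrow> A \<noteq> B \<Longrightarrow> card (A \<inter> B) < t"
    "t ^ t \<le> card \<A>"
proof -
  have 1: "t \<le> t\<^sup>2" using t by (simp add: power2_eq_square)
  have 2: "t\<^sup>2 \<le> t ^ 6" using t by (intro power_increasing) auto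
  obtain \<A> where A: "\<A> \<subseteq> {A. A \<subseteq> {..<p} \<and> card A = t\<^sup>2}"
    "\<And>A B. A \<in> \<A> \<Longrightarrow> B \<in> \<A> \<Longrightarrow> A \<noteq> B \<Longrightarrow> card (A \<inter> B) < t"
    "p choose t \<le> card \<A> * (t\<^sup>2 choose t)\<^sup>2"
    using nearly_disjoint_subsets[of t "t\<^sup>2" p] 1 2 p by auto
  have "real t ^ 5 \<le> real p / real t"
    using t p by (simp add: pos_le_divide_eq flip: of_nat_power of_nat_mult power_Suc2)
  then have "(real t ^ 5) ^ t \<le> (real p / real t) ^ t"
    by (intro power_mono) auto
  also have "\<dots> \<le> real (p choose t)"
    using binomial_ge_n_over_k_pow_k[of t p, where 'a = real] 1 2 p by auto
  also have "\<dots> \<le> real (card \<A>) * (real (t\<^sup>2 choose t))\<^sup>2"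
    using A(3) by (metis of_nat_le_iff of_nat_mult of_nat_power)
  also have "\<dots> \<le> real (card \<A>) * ((real t)\<^sup>2 ^ t)\<^sup>2"
    using binomial_le_pow[OF 1] 
    by (intro mult_left_mono power_mono) (auto simp flip: of_nat_power)
  also have "((real t)\<^sup>2 ^ t)\<^sup>2 = (real t ^ 4) ^ t"
    by (simp flip: power_mult add: mult.commute mult.left_commute)
  finally have "(real t ^ 5) ^ t \<le> real (card \<A>) * (real t ^ 4) ^ t" .
  also have "(real t ^ 5) ^ t = real t ^ t * (real t ^ 4) ^ t"
    by (simp flip: power_mult_distrib power_Suc)
  finally have "real t ^ t \<le> real (card \<A>)" using t by simp
  then have "t ^ t \<le> card \<A>" by (metis of_nat_le_iff of_nat_power)
  with A show ?thesis by (intro that)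
qed

section \<open>Gaussian estimates\<close>

lemma normal_density_shift: "normal_density m s y = normal_density 0 s (y - m)"
  by (simp add: normal_density_def)

lemma normal_density_0_2: "normal_density 0 2 y = exp (- y\<^sup>2 / 8) / (2 * sqrt (2 * pi))"
  unfolding normal_density_def real_sqrt_mult[of "2 * pi" "2\<^sup>2"] real_sqrt_abs by simp

lemma abs_le_exp_sq_div_4: "\<bar>u\<bar> \<le> exp (u\<^sup>2 / 4 :: real)"
proof -
  have "0 \<le> (\<bar>u\<bar> / 2 - 1)\<^sup>2" by simp
  then have "\<bar>u\<bar> \<le> 1 + u\<^sup>2 / 4" by (simp add: power2_eq_square algebra_simps)
  also have "\<dots> \<le> exp (u\<^sup>2 / 4)" by (rule exp_ge_add_one_self)
  finally show ?thesis .
qed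

text \<open>
  The widened Gaussian on the right is the default contamination.  The factor \<open>\<bar>s\<bar>\<close> is what makes a
  contamination of order \<open>\<bar>s\<bar>\<close> sufficient to hide a shift by \<open>s\<close>.
\<close>

lemma abs_normal_density_diff_le:
  "\<bar>normal_density s 1 y - normal_density 0 1 y\<bar> \<le> 2 * \<bar>s\<bar> * exp (s\<^sup>2 / 4) * normal_density 0 2 y"
proof -
  define f where "f u = exp (- u\<^sup>2 / 2)" for u :: real
  have f': "(f has_real_derivative (- u * exp (- u\<^sup>2 / 2))) (at u)" for u
    unfolding f_def by (auto intro!: derivative_eq_intros)
  \<comment> \<open>Derivative bound for the mean value inequality between y - s and y. Half of the
    exponent - u^2 / 2 absorbs the factor |u|; the other half is traded, through y^2 \<le> 2 u^2 + 2
    s^2, for the exponent - y^2 / 8 of the widened Gaussian.\<close>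
  have d: "\<bar>- u * exp (- u\<^sup>2 / 2)\<bar> \<le> exp (s\<^sup>2 / 4) * exp (- y\<^sup>2 / 8)"
    if "min y (y - s) \<le> u" "u \<le> max y (y - s)" for u
  proof -
    have "\<bar>- u * exp (- u\<^sup>2 / 2)\<bar> = \<bar>u\<bar> * exp (- u\<^sup>2 / 2)" by (simp add: abs_mult)
    also have "\<dots> \<le> exp (u\<^sup>2 / 4) * exp (- u\<^sup>2 / 2)"
      by (intro mult_right_mono abs_le_exp_sq_div_4) auto
    also have "\<dots> = exp (- u\<^sup>2 / 4)" by (simp flip: exp_add)
    also have "exp (- u\<^sup>2 / 4) \<le> exp (s\<^sup>2 / 4 + - y\<^sup>2 / 8)"
    proof (subst exp_le_cancel_iff)
      have "(y - u)\<^sup>2 \<le> s\<^sup>2" using that by (intro abs_le_square_iff[THEN iffD1]) auto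
      moreover have "y\<^sup>2 \<le> 2 * u\<^sup>2 + 2 * (y - u)\<^sup>2"
        using zero_le_power2[of "2 * u - y"] by (simp add: power2_eq_square algebra_simps)
      ultimately show "- u\<^sup>2 / 4 \<le> s\<^sup>2 / 4 + - y\<^sup>2 / 8" by simp
    qed
    finally show ?thesis by (simp only: exp_add)
  qed
  have "norm (f (y - s) - f y) \<le> (exp (s\<^sup>2 / 4) * exp (- y\<^sup>2 / 8)) * norm (y - s - y)"
  proof (rule field_differentiable_bound[where S = "{min y (y - s)..max y (y - s)}"])
    fix u
    show "(f has_field_derivative (- u * exp (- u\<^sup>2 / 2))) (at u within {min y (y - s)..max y (y - s)})"
      using f' by (rule has_field_derivative_at_within)
    show "norm (- u * exp (- u\<^sup>2 / 2)) \<le> exp (s\<^sup>2 / 4) * exp (- y\<^sup>2 / 8)"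
      if "u \<in> {min y (y - s)..max y (y - s)}"
      using d[of u] that by simp
  qed auto
  then have "\<bar>f (y - s) - f y\<bar> / sqrt (2 * pi) \<le> \<bar>s\<bar> * (exp (s\<^sup>2 / 4) * exp (- y\<^sup>2 / 8)) / sqrt (2 * pi)"
    by (intro divide_right_mono) (auto simp: mult.commute)
  moreover have "normal_density s 1 y - normal_density 0 1 y = (f (y - s) - f y) / sqrt (2 * pi)"
    by (simp add: normal_density_def f_def diff_divide_distrib)
  moreover note normal_density_0_2[of y]
  ultimately show ?thesis by (simp add: abs_divide)
qed

text \<open>The product majorant is the form that \<open>abs_kernel_le\<close> supplies once one of
  the three variables t, u, y is frozen.\<close>

lemma integral_swap_dominated:
  fixes F :: "real \<Rightarrow> real \<Rightarrow> real"
  assumes F[measurable]: "(\<lambda>(x, y). F x y) \<in> borel_measurable (borel \<Otimes>\<^sub>M borel)"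
    and g: "integrable lborel g" and h: "integrable lborel h"
    and le: "\<And>x y. \<bar>F x y\<bar> \<le> g x * h y"
  shows "(\<integral>x. (\<integral>y. F x y \<partial>lborel) \<partial>lborel) = (\<integral>y. (\<integral>x. F x y \<partial>lborel) \<partial>lborel)"
    and "integrable lborel (\<lambda>x. \<integral>y. F x y \<partial>lborel)"
    and "integrable lborel (\<lambda>y. \<integral>x. F x y \<partial>lborel)"
proof -
  have [measurable]: "g \<in> borel_measurable borel" "h \<in> borel_measurable borel"
    using g h by auto
  have "integrable (lborel \<Otimes>\<^sub>M lborel) (\<lambda>(x, y). g x * h y)"
    using g h by (intro lborel_pair.Fubini_integrable) (auto simp: abs_mult)
  then have int: "integrable (lborel \<Otimes>\<^sub>M lborel) (\<lambda>(x, y). F x y)"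
    by (rule Bochner_Integration.integrable_bound)
      (auto intro!: AE_I2 order_trans[OF le] abs_ge_self)
  show "(\<integral>x. (\<integral>y. F x y \<partial>lborel) \<partial>lborel) = (\<integral>y. (\<integral>x. F x y \<partial>lborel) \<partial>lborel)"
    using lborel_pair.Fubini_integral[OF int] by simp
  show "integrable lborel (\<lambda>x. \<integral>y. F x y \<partial>lborel)"
    using lborel_pair.integrable_fst[OF int] by simp
  show "integrable lborel (\<lambda>y. \<integral>x. F x y \<partial>lborel)"
    using lborel_pair.integrable_snd[OF int] by simp
qed

lemma power_div_fact_le_exp:
  fixes x :: real
  assumes "0 \<le> x"
  shows "x ^ n / fact n \<le> exp x"
proof -
  have "x ^ n / fact n \<le> (\<Sum>i. x ^ i / fact i)"
    using sum_le_suminf[OF summable_exp_generic[of x], of "{n}"] assms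
    by (simp add: divide_inverse_commute)
  then show ?thesis by (simp add: exp_def divide_inverse_commute)
qed

section \<open>Contamination that matches moments\<close>

text \<open>The product is k! (m - k)!, that is m! divided by a binomial coefficient, which is at
  most 2^m. It bounds the denominators of the Lagrange basis from below.\<close>

lemma prod_dist_nodes_ge:
  assumes "k \<le> m"
  shows "fact m / 2 ^ m \<le> (\<Prod>l\<in>{..m} - {k}. \<bar>real k - real l\<bar>)"
proof -
  have 1: "(\<Prod>l<k. \<bar>real k - real l\<bar>) = fact k"
  proof -
    have "(\<Prod>l<k. \<bar>real k - real l\<bar>) = (\<Prod>i\<in>{1..k}. real i)"
      by (rule prod.reindex_bij_witness[of _ "\<lambda>i. k - i" "\<lambda>l. k - l"]) auto
    then show ?thesis by (simp add: fact_prod)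
  qed
  have 2: "(\<Prod>l\<in>{k<..m}. \<bar>real k - real l\<bar>) = fact (m - k)"
  proof -
    have "(\<Prod>l\<in>{k<..m}. \<bar>real k - real l\<bar>) = (\<Prod>i\<in>{1..m - k}. real i)"
      by (rule prod.reindex_bij_witness[of _ "\<lambda>i. k + i" "\<lambda>l. l - k"]) auto
    then show ?thesis by (simp add: fact_prod)
  qed
  have "{..m} - {k} = {..<k} \<union> {k<..m}" using assms by auto
  then have "(\<Prod>l\<in>{..m} - {k}. \<bar>real k - real l\<bar>) = fact k * fact (m - k)"
    using 1 2 by (simp add: prod.union_disjoint Int_def)
  moreover have "fact m = (fact k * fact (m - k) * real (m choose k) :: real)"
    using binomial_fact_lemma[OF assms] by (metis of_nat_fact of_nat_mult)
  moreover have "real (m choose k) \<le> 2 ^ m"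
    using choose_row_sum[of m] member_le_sum[of k "{..m}" "\<lambda>k. m choose k"] assms
    by (metis (no_types, lifting) atMost_iff finite_atMost of_nat_le_iff of_nat_numeral of_nat_power zero_le)
  ultimately show ?thesis
    by (simp add: field_simps mult_left_mono)
qed

text \<open>
  Parameters: \<open>\<kappa>\<close> is the length of the hidden regression vector \<open>b\<close>, and \<open>t\<close> below stands for the
  coordinate of \<open>X\<close> along \<open>b\<close>.  On \<open>\<bar>t\<bar> \<le> T\<close> the contamination can make the response independent of
  \<open>t\<close>, and moments up to degree \<open>m\<close>, of order \<open>T\<^sup>2\<close>, will be matched.
\<close>

locale hidden_shift =
  fixes eps T \<kappa> :: real and m :: nat
  assumes eps: "0 < eps" "eps < 1 / 2"
    and T: "0 < T" and \<kappa>T: "6 * \<kappa> * T = eps"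
    and mT: "64 * (real m + 1) \<le> T\<^sup>2"
begin

lemma T_ge: "8 \<le> T"
proof (rule ccontr)
  assume "\<not> 8 \<le> T"
  then have "T\<^sup>2 < 8\<^sup>2" using T by (intro power_strict_mono) auto
  with mT show False by simp
qed

lemma \<kappa>_pos: "0 < \<kappa>"
  using eps(1) T unfolding \<kappa>T[symmetric] by (simp add: zero_less_mult_iff)

lemma \<kappa>_le: "\<kappa> \<le> 1 / 96"
proof -
  have "6 * \<kappa> * 8 \<le> 6 * \<kappa> * T" using T_ge \<kappa>_pos by (intro mult_left_mono) auto
  then show ?thesis using \<kappa>T eps by simp
qed

lemma \<kappa>_sq_le: "\<kappa>\<^sup>2 \<le> 1 / 4"
  using power_mono[of \<kappa> "1 / 2" 2] \<kappa>_le \<kappa>_pos by (simp add: power_divide)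

section \<open>Lagrange extrapolation from cells of [0, T / 4)\<close>

definition \<eta> :: real where "\<eta> = T / (4 * (real m + 1))"

lemma \<eta>_pos: "0 < \<eta>" using T by (simp add: \<eta>_def)

definition lag :: "nat \<Rightarrow> real \<Rightarrow> real" where
  "lag k x = (\<Prod>l\<in>{..m} - {k}. (x - real l * \<eta>) / ((real k - real l) * \<eta>))"

lemma measurable_lag[measurable]: "lag k \<in> borel_measurable borel"
  unfolding lag_def by measurable

lemma lag_node: "k \<le> m \<Longrightarrow> l \<le> m \<Longrightarrow> lag k (real l * \<eta>) = (if l = k then 1 else 0)"
  using \<eta>_pos unfolding lag_def
  by (cases "l = k") (auto simp flip: left_diff_distrib intro!: prod.neutral bexI[of _ l])

text \<open>The polynomial (X + s)^j has degree at most m, hence equals its interpolant at the nodes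
  \<open>k * \<eta>\<close>. Evaluation at t - s gives the extrapolation formula from the translated
  nodes \<open>k * \<eta> + s\<close> to t.\<close>

lemma lagrange_interpolation:
  assumes j: "j \<le> m"
  shows "(\<Sum>k\<le>m. lag k (t - s) * (real k * \<eta> + s) ^ j) = t ^ j"
proof -
  define L where "L k = (\<Prod>l\<in>{..m} - {k}. smult (1 / ((real k - real l) * \<eta>)) [:- (real l * \<eta>), 1:])" for k
  define P where "P = (\<Sum>k\<le>m. smult ((real k * \<eta> + s) ^ j) (L k))"
  have pL: "poly (L k) x = lag k x" for k x
    by (simp add: L_def lag_def poly_prod algebra_simps diff_divide_distrib)
  have pP: "poly P x = (\<Sum>k\<le>m. lag k x * (real k * \<eta> + s) ^ j)" for x
    by (simp add: P_def poly_sum pL mult.commute)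
  have dL: "degree (L k) \<le> m" if "k \<le> m" for k
  proof -
    have "degree (L k) \<le> (\<Sum>l\<in>{..m} - {k}. degree (smult (1 / ((real k - real l) * \<eta>)) [:- (real l * \<eta>), 1:]))"
      unfolding L_def by (rule degree_prod_sum_le[unfolded o_def]) auto
    also have "\<dots> \<le> (\<Sum>l\<in>{..m} - {k}. 1)" by (intro sum_mono) auto
    also have "\<dots> = m" using that by simp
    finally show ?thesis .
  qed
  have "P = [:s, 1:] ^ j"
  proof (rule poly_eqI_degree[of "(\<lambda>k. real k * \<eta>) ` {..m}"])
    have inj: "inj_on (\<lambda>k. real k * \<eta>) {..m}" using \<eta>_pos by (auto simp: inj_on_def)
    show "degree P < card ((\<lambda>k. real k * \<eta>) ` {..m})"
      unfolding P_def card_image[OF inj] using dL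
      by (auto intro!: le_imp_less_Suc degree_sum_le order_trans[OF degree_smult_le])
    show "degree ([:s, 1:] ^ j) < card ((\<lambda>k. real k * \<eta>) ` {..m})"
      unfolding card_image[OF inj] using j by (auto simp: degree_linear_power)
    fix x assume "x \<in> (\<lambda>k. real k * \<eta>) ` {..m}"
    then obtain l where l: "l \<le> m" "x = real l * \<eta>" by auto
    have "poly P x = (\<Sum>k\<le>m. if k = l then (real k * \<eta> + s) ^ j else 0)"
      unfolding pP l(2) using l(1) by (intro sum.cong) (auto simp: lag_node)
    then show "poly P x = poly ([:s, 1:] ^ j) x"
      using l by (simp add: poly_power add.commute)
  qed
  then show ?thesis using pP[of "t - s"] by (simp add: poly_power)
qed

text \<open>
  The Lagrange extrapolation formula from the nodes \<open>k \<eta> + s\<close> to \<open>t\<close>, averaged over \<open>s \<in> [0, \<eta>)\<close> and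
  written as a signed density in \<open>u = k \<eta> + s\<close>.
\<close>

definition chi :: "real \<Rightarrow> real \<Rightarrow> real" where
  "chi t u = (\<Sum>k\<le>m. indicator {real k * \<eta>..<(real k + 1) * \<eta>} u * (lag k (t - (u - real k * \<eta>)) / \<eta>))"

lemma measurable_chi[measurable (raw)]:
  assumes [measurable]: "f \<in> borel_measurable M" "g \<in> borel_measurable M"
  shows "(\<lambda>x. chi (f x) (g x)) \<in> borel_measurable M"
  unfolding chi_def by measurable

text \<open>The spacing is chosen for this: the m + 1 cells exactly fill [0, T / 4), well inside the
  zone where the contamination has slack and where the Gaussian density is not too small.\<close>

lemma nodes_end: "(real m + 1) * \<eta> = T / 4"
  by (simp add: \<eta>_def field_simps)

text \<open>All nodes lie in [0, T / 4] and t does not lie closer to 0 than T / 4, so each numerator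
  is at most 2 |t|. With the factorial bound on the denominators this is (4 |t| / \<eta>)^m / m!,
  and 4 / \<eta> = 16 (m + 1) / T. Finally (m + 1)^m / m! \<le> exp (m + 1) and 16 \<le> exp 4
  account for the 5 in the exponent.\<close>

lemma abs_lag_le:
  assumes k: "k \<le> m" and s: "0 \<le> s" "s \<le> \<eta>" and t: "T / 4 \<le> \<bar>t\<bar>"
  shows "\<bar>lag k (t - s)\<bar> \<le> exp (5 * (real m + 1)) * (\<bar>t\<bar> / T) ^ m"
proof -
  let ?I = "{..m} - {k}"
  have c: "card ?I = m" using k by simp
  have num: "\<bar>t - s - real l * \<eta>\<bar> \<le> 2 * \<bar>t\<bar>" if "l \<in> ?I" for l
  proof -
    have "(1 + real l) * \<eta> \<le> (real m + 1) * \<eta>" if "l \<le> m" for l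
      using that \<eta>_pos by (intro mult_right_mono) auto
    from this[of l] that have "s + real l * \<eta> \<le> T / 4" "0 \<le> real l * \<eta>"
      using s \<eta>_pos unfolding nodes_end by (auto simp: algebra_simps)
    then show ?thesis using t s by linarith
  qed
  have "\<bar>lag k (t - s)\<bar> = (\<Prod>l\<in>?I. \<bar>t - s - real l * \<eta>\<bar>) / ((\<Prod>l\<in>?I. \<bar>real k - real l\<bar>) * \<eta> ^ m)"
    using \<eta>_pos c by (simp add: lag_def abs_prod abs_mult prod_dividef prod.distrib)
  also have "\<dots> \<le> (2 * \<bar>t\<bar>) ^ m / (fact m / 2 ^ m * \<eta> ^ m)"
  proof (intro frac_le mult_right_mono prod_dist_nodes_ge k)
    have "(\<Prod>l\<in>?I. \<bar>t - s - real l * \<eta>\<bar>) \<le> (\<Prod>l\<in>?I. 2 * \<bar>t\<bar>)"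
      using num by (intro prod_mono) auto
    then show "(\<Prod>l\<in>?I. \<bar>t - s - real l * \<eta>\<bar>) \<le> (2 * \<bar>t\<bar>) ^ m" using c by simp
  qed (use \<eta>_pos in auto)
  also have "\<dots> = (\<bar>t\<bar> / T) ^ m * (16 ^ m * ((real m + 1) ^ m / fact m))"
  proof -
    have "(2 * \<bar>t\<bar>) ^ m / (fact m / 2 ^ m * \<eta> ^ m) = ((2 * \<bar>t\<bar>) ^ m * 2 ^ m / \<eta> ^ m) / fact m"
      by simp
    also have "\<dots> = (2 * \<bar>t\<bar> * 2 / \<eta>) ^ m / fact m"
      by (simp only: power_mult_distrib power_divide)
    also have "2 * \<bar>t\<bar> * 2 / \<eta> = (\<bar>t\<bar> / T) * (16 * (real m + 1))"
      using T by (simp add: \<eta>_def)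
    finally show ?thesis by (simp only: power_mult_distrib times_divide_eq_right)
  qed
  also have "\<dots> \<le> (\<bar>t\<bar> / T) ^ m * (exp 4 ^ m * exp (real m + 1))"
  proof (intro mult_left_mono mult_mono power_mono)
    have "(2::real) ^ 4 \<le> exp 1 ^ 4" using exp_ge_add_one_self[of "1::real"] by (intro power_mono) auto
    also have "exp 1 ^ 4 = exp (4::real)" using exp_of_nat_mult[of 4 "1::real"] by simp
    finally show "16 \<le> exp (4::real)" by simp
    show "(real m + 1) ^ m / fact m \<le> exp (real m + 1)"
      by (rule power_div_fact_le_exp) simp
  qed (use T in auto)
  also have "\<dots> \<le> (\<bar>t\<bar> / T) ^ m * exp (5 * (real m + 1))"
    using T by (intro mult_left_mono) (auto simp flip: exp_of_nat_mult exp_add)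
  finally show ?thesis by (simp only: mult.commute)
qed

text \<open>The cells are disjoint, but bounding the sum by all m + 1 terms costs only a factor that
  the exponentials absorb later.\<close>

lemma abs_chi_le:
  assumes t: "T / 4 \<le> \<bar>t\<bar>"
  shows "\<bar>chi t u\<bar> \<le> indicator {0..<T / 4} u * ((real m + 1) / \<eta> * exp (5 * (real m + 1)) * (\<bar>t\<bar> / T) ^ m)"
proof (cases "u \<in> {0..<T / 4}")
  case False
  have "u \<notin> {real k * \<eta>..<(real k + 1) * \<eta>}" if "k \<le> m" for k
  proof -
    have "(real k + 1) * \<eta> \<le> (real m + 1) * \<eta>" "0 \<le> real k * \<eta>"
      using that \<eta>_pos by (auto intro!: mult_right_mono)
    with False show ?thesis unfolding nodes_end by auto
  qed
  then have "chi t u = 0" unfolding chi_def by (intro sum.neutral) (auto simp: indicator_def)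
  then show ?thesis using False by simp
next
  case True
  have "\<bar>chi t u\<bar> \<le> (\<Sum>k\<le>m. \<bar>indicator {real k * \<eta>..<(real k + 1) * \<eta>} u * (lag k (t - (u - real k * \<eta>)) / \<eta>)\<bar>)"
    unfolding chi_def by (rule sum_abs)
  also have "\<dots> \<le> (\<Sum>k\<le>m. exp (5 * (real m + 1)) * (\<bar>t\<bar> / T) ^ m / \<eta>)"
  proof (rule sum_mono)
    fix k assume "k \<in> {..m}"
    then show "\<bar>indicator {real k * \<eta>..<(real k + 1) * \<eta>} u * (lag k (t - (u - real k * \<eta>)) / \<eta>)\<bar>
        \<le> exp (5 * (real m + 1)) * (\<bar>t\<bar> / T) ^ m / \<eta>"
      using \<eta>_pos T t abs_lag_le[of k "u - real k * \<eta>" t]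
      by (auto simp: indicator_def divide_right_mono algebra_simps)
  qed
  finally show ?thesis using True by (simp add: field_simps)
qed

text \<open>Translating each cell to [0, \<eta>) by u = k \<eta> + s turns the sum over k into
  \<open>lagrange_interpolation\<close> for each fixed s; the factor 1 / \<eta> makes the integral
  over s an average.\<close>

lemma chi_moment:
  assumes j: "j \<le> m"
  shows "(\<integral>u. chi t u * u ^ j \<partial>lborel) = t ^ j"
proof -
  let ?f = "\<lambda>k s. indicator {0..<\<eta>} s * (lag k (t - s) * (real k * \<eta> + s) ^ j / \<eta>)"
  have int: "integrable lborel (?f k)" for k
  proof -
    have "set_integrable lborel {0..\<eta>} (\<lambda>s. lag k (t - s) * (real k * \<eta> + s) ^ j / \<eta>)"
      unfolding lag_def using \<eta>_pos
      by (intro borel_integrable_atLeastAtMost') (auto intro!: continuous_intros)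
    then have "set_integrable lborel {0..<\<eta>} (\<lambda>s. lag k (t - s) * (real k * \<eta> + s) ^ j / \<eta>)"
      by (rule set_integrable_subset) auto
    then show ?thesis by (simp add: set_integrable_def)
  qed
  have eq: "indicator {real k * \<eta>..<(real k + 1) * \<eta>} (real k * \<eta> + s) *
       (lag k (t - (real k * \<eta> + s - real k * \<eta>)) / \<eta>) * (real k * \<eta> + s) ^ j = ?f k s" for k s
    by (auto simp: indicator_def algebra_simps)
  have "chi t u * u ^ j = (\<Sum>k\<le>m. indicator {real k * \<eta>..<(real k + 1) * \<eta>} u * (lag k (t - (u - real k * \<eta>)) / \<eta>) * u ^ j)" for u
    by (simp add: chi_def sum_distrib_right)
  moreover have int': "integrable lborel (\<lambda>u. indicator {real k * \<eta>..<(real k + 1) * \<eta>} u * (lag k (t - (u - real k * \<eta>)) / \<eta>) * u ^ j)" for k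
    using int[of k] lborel_integrable_real_affine_iff[of 1 "\<lambda>u. indicator {real k * \<eta>..<(real k + 1) * \<eta>} u * (lag k (t - (u - real k * \<eta>)) / \<eta>) * u ^ j" "real k * \<eta>"]
    by (simp only: eq mult_1 one_neq_zero simp_thms not_False_eq_True)
  ultimately have "(\<integral>u. chi t u * u ^ j \<partial>lborel) = (\<Sum>k\<le>m. \<integral>u. indicator {real k * \<eta>..<(real k + 1) * \<eta>} u * (lag k (t - (u - real k * \<eta>)) / \<eta>) * u ^ j \<partial>lborel)"
    by (simp add: Bochner_Integration.integral_sum)
  also have "\<dots> = (\<Sum>k\<le>m. \<integral>s. ?f k s \<partial>lborel)"
  proof (rule sum.cong[OF refl])
    fix k
    show "(\<integral>u. indicator {real k * \<eta>..<(real k + 1) * \<eta>} u * (lag k (t - (u - real k * \<eta>)) / \<eta>) * u ^ j \<partial>lborel) = (\<integral>s. ?f k s \<partial>lborel)"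
      by (subst lborel_integral_real_affine[of 1 _ "real k * \<eta>"]) (simp_all only: eq mult_1 one_neq_zero simp_thms not_False_eq_True abs_one scaleR_one)
  qed
  also have "\<dots> = (\<integral>s. (\<Sum>k\<le>m. ?f k s) \<partial>lborel)"
    using int by (simp add: Bochner_Integration.integral_sum)
  also have "\<dots> = (\<integral>s. indicator {0..<\<eta>} s * (t ^ j / \<eta>) \<partial>lborel)"
    using lagrange_interpolation[OF j, of t] 
    by (intro Bochner_Integration.integral_cong refl) (simp flip: sum_distrib_left sum_divide_distrib)
  also have "\<dots> = t ^ j" using \<eta>_pos by simp
  finally show ?thesis .
qed

section \<open>The deviation caused by large coordinates and its moment correction\<close>

definition tail :: "real \<Rightarrow> real \<Rightarrow> real" where
  "tail t y = (if \<bar>t\<bar> \<le> T then 0 else normal_density (\<kappa> * t) 1 y - normal_density 0 1 y)"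

text \<open>Integrating the weighted tail against \<open>chi\<close> transports it into [0, T / 4).
  By \<open>chi_moment\<close> and Fubini the result has, for each y, the same moments of degree at
  most m as the weighted tail.\<close>

definition moved :: "real \<Rightarrow> real \<Rightarrow> real" where
  "moved u y = (\<integral>t. std_normal_density t * tail t y * chi t u \<partial>lborel)"

text \<open>
  The deviation from independence: outside \<open>[-T, T]\<close> it is the effect of the shift by \<open>\<kappa> t\<close>, and
  its low moments in \<open>t\<close> are cancelled inside \<open>[0, T / 4)\<close>.
\<close>

definition dev :: "real \<Rightarrow> real \<Rightarrow> real" where
  "dev t y = tail t y - moved t y / std_normal_density t"

lemma measurable_tail[measurable (raw)]:
  assumes [measurable]: "f \<in> borel_measurable M" "g \<in> borel_measurable M"
  shows "(\<lambda>x. tail (f x) (g x)) \<in> borel_measurable M"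
  unfolding tail_def normal_density_def by measurable

lemma measurable_moved[measurable (raw)]:
  assumes [measurable]: "f \<in> borel_measurable M" "g \<in> borel_measurable M"
  shows "(\<lambda>x. moved (f x) (g x)) \<in> borel_measurable M"
  unfolding moved_def by measurable

lemma measurable_dev[measurable (raw)]:
  assumes [measurable]: "f \<in> borel_measurable M" "g \<in> borel_measurable M"
  shows "(\<lambda>x. dev (f x) (g x)) \<in> borel_measurable M"
  unfolding dev_def by measurable

lemma abs_tail_le:
  "\<bar>tail t y\<bar> \<le> 2 * \<kappa> * \<bar>t\<bar> * exp (t\<^sup>2 / 16) * normal_density 0 2 y"
proof -
  have "\<bar>tail t y\<bar> \<le> \<bar>normal_density (\<kappa> * t) 1 y - normal_density 0 1 y\<bar>"
    by (simp add: tail_def)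
  also have "\<dots> \<le> 2 * \<bar>\<kappa> * t\<bar> * exp ((\<kappa> * t)\<^sup>2 / 4) * normal_density 0 2 y"
    by (rule abs_normal_density_diff_le)
  also have "\<dots> \<le> 2 * \<bar>\<kappa> * t\<bar> * exp (t\<^sup>2 / 16) * normal_density 0 2 y"
    using mult_right_mono[OF \<kappa>_sq_le, of "t\<^sup>2"]
    by (intro mult_right_mono mult_left_mono) (auto simp: power_mult_distrib)
  finally show ?thesis using \<kappa>_pos by (simp add: abs_mult mult_ac)
qed

text \<open>Calibrated to the Gaussian density on [0, T / 4), which is at least exp (- T^2 / 8) / 6:
  the quotient of the two is \<open>eps / 2\<close>, the half of the budget reserved for the
  correction.\<close>

definition H0 :: real where "H0 = eps / 12 * exp (- T\<^sup>2 / 8)"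

text \<open>Since 64 m \<le> T^2, the power (|t| / T)^m costs only exp (t^2 / 128), and |t| costs 2
  exp (t^2 / 16). The remaining exponent - 47 t^2 / 128 is more than enough to be split: 28 / 128 of
  it is spent, by |t| > T, on smallness in T, and 16 / 128 is kept as a Gaussian in t for
  integrability.\<close>

lemma tail_weight_le:
  assumes t: "T < \<bar>t\<bar>"
  shows "std_normal_density t * \<bar>t\<bar> * exp (t\<^sup>2 / 16) * (\<bar>t\<bar> / T) ^ m
    \<le> 4 * exp (- 7 * T\<^sup>2 / 32) * normal_density 0 2 t"
proof -
  have m: "real m / T\<^sup>2 \<le> 1 / 64" using mT T by (simp add: field_simps)
  have "(\<bar>t\<bar> / T) ^ m \<le> exp (real m * (t\<^sup>2 / (2 * T\<^sup>2)))"
  proof -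
    have "x \<le> 1 + x\<^sup>2 / 2" for x :: real
      using zero_le_power2[of "x - 1"] by (simp add: power2_eq_square algebra_simps)
    then have "\<bar>t\<bar> / T \<le> 1 + (\<bar>t\<bar> / T)\<^sup>2 / 2" .
    also have "\<dots> \<le> exp ((\<bar>t\<bar> / T)\<^sup>2 / 2)" by (rule exp_ge_add_one_self)
    finally have "(\<bar>t\<bar> / T) ^ m \<le> exp ((\<bar>t\<bar> / T)\<^sup>2 / 2) ^ m" using T by (intro power_mono) auto
    then show ?thesis by (simp add: power_divide field_simps flip: exp_of_nat_mult)
  qed
  also have "\<dots> \<le> exp (t\<^sup>2 / 128)"
    using mult_right_mono[OF m, of "t\<^sup>2 / 2"] by (simp add: field_simps)
  finally have 1: "(\<bar>t\<bar> / T) ^ m \<le> exp (t\<^sup>2 / 128)" .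
  have 2: "\<bar>t\<bar> \<le> 2 * exp (t\<^sup>2 / 16)"
    using abs_le_exp_sq_div_4[of "t / 2"] by (simp add: power_divide)
  have "std_normal_density t * \<bar>t\<bar> * exp (t\<^sup>2 / 16) * (\<bar>t\<bar> / T) ^ m
      \<le> std_normal_density t * (2 * exp (t\<^sup>2 / 16)) * exp (t\<^sup>2 / 16) * exp (t\<^sup>2 / 128)"
    using 1 2 T by (intro mult_mono) auto
  also have "\<dots> = 2 / sqrt (2 * pi) * exp (- 47 * t\<^sup>2 / 128)"
    by (simp add: std_normal_density_def mult_ac flip: exp_add)
  also have "\<dots> \<le> 2 / sqrt (2 * pi) * exp (- 7 * T\<^sup>2 / 32 + - t\<^sup>2 / 8)"
  proof -
    have "T\<^sup>2 \<le> t\<^sup>2" using t T by (intro abs_le_square_iff[THEN iffD1]) auto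
    then have "- 47 * t\<^sup>2 / 128 \<le> - 7 * T\<^sup>2 / 32 + - t\<^sup>2 / 8"
      using zero_le_power2[of t] by linarith
    then show ?thesis by (intro mult_left_mono) auto
  qed
  also have "\<dots> = 4 * exp (- 7 * T\<^sup>2 / 32) * normal_density 0 2 t"
    by (simp only: normal_density_0_2 exp_add) simp
  finally show ?thesis .
qed

text \<open>Extrapolation growth meets Gaussian decay here. The exponent 6 (m + 1) - 7 T^2 / 32 is
  at most - T^2 / 8 precisely when 64 (m + 1) \<le> T^2, which is the origin of
  \<open>mT\<close>.\<close>

lemma abs_kernel_le:
  "\<bar>std_normal_density t * tail t y * chi t u\<bar>
    \<le> H0 * normal_density 0 2 t * normal_density 0 2 y * indicator {0..<T / 4} u"
proof (cases "\<bar>t\<bar> \<le> T")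
  case True
  then show ?thesis using eps by (simp add: tail_def H0_def)
next
  case False
  let ?M = "real m + 1"
  have "\<bar>std_normal_density t * tail t y * chi t u\<bar> \<le>
     std_normal_density t * (2 * \<kappa> * \<bar>t\<bar> * exp (t\<^sup>2 / 16) * normal_density 0 2 y) *
     (indicator {0..<T / 4} u * (?M / \<eta> * exp (5 * ?M) * (\<bar>t\<bar> / T) ^ m))"
    unfolding abs_mult using False T \<kappa>_pos
    by (intro mult_mono abs_tail_le abs_chi_le) auto
  also have "\<dots> = (std_normal_density t * \<bar>t\<bar> * exp (t\<^sup>2 / 16) * (\<bar>t\<bar> / T) ^ m) *
     (2 * \<kappa> * ?M / \<eta> * exp (5 * ?M) * normal_density 0 2 y * indicator {0..<T / 4} u)"
    by simp
  also have "\<dots> \<le> (4 * exp (- 7 * T\<^sup>2 / 32) * normal_density 0 2 t) *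
     (2 * \<kappa> * ?M / \<eta> * exp (5 * ?M) * normal_density 0 2 y * indicator {0..<T / 4} u)"
    using False \<kappa>_pos \<eta>_pos by (intro mult_right_mono tail_weight_le) auto
  also have "\<dots> = (8 * \<kappa> * ?M / \<eta> * exp (5 * ?M) * exp (- 7 * T\<^sup>2 / 32)) *
      (normal_density 0 2 t * normal_density 0 2 y * indicator {0..<T / 4} u)"
    by simp
  also have "8 * \<kappa> * ?M / \<eta> * exp (5 * ?M) * exp (- 7 * T\<^sup>2 / 32) \<le> H0"
  proof -
    have "8 * \<kappa> * ?M / \<eta> = eps * (16 / 3) * (?M / T\<^sup>2) * ?M"
      using T \<kappa>T[symmetric] by (simp add: \<eta>_def field_simps power2_eq_square)
    \<comment> \<open>One factor (m + 1) / T^2 is at most 1 / 64, which produces 16 / 3 / 64 = 1 /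
      12; the leftover m + 1 goes into one more exponential, raising 5 (m + 1) to 6 (m + 1).\<close>
    also have "\<dots> \<le> eps * (16 / 3) * (1 / 64) * exp ?M"
      using eps mT T exp_ge_add_one_self[of ?M] by (intro mult_mono) (auto simp: field_simps)
    finally have "8 * \<kappa> * ?M / \<eta> * exp (5 * ?M) * exp (- 7 * T\<^sup>2 / 32)
        \<le> eps * (16 / 3) * (1 / 64) * exp ?M * exp (5 * ?M) * exp (- 7 * T\<^sup>2 / 32)"
      by (intro mult_right_mono) auto
    also have "\<dots> = eps / 12 * exp (6 * ?M - 7 * T\<^sup>2 / 32)"
      by (simp add: mult.assoc flip: exp_add)
    also have "\<dots> \<le> H0"
      unfolding H0_def using eps mT by (intro mult_left_mono) auto
    finally show ?thesis .
  qed
  finally show ?thesis by (simp add: mult_right_mono mult.assoc)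
qed

lemma abs_moved_le:
  "\<bar>moved u y\<bar> \<le> H0 * normal_density 0 2 y * indicator {0..<T / 4} u"
proof -
  have "\<bar>moved u y\<bar> \<le> (\<integral>t. H0 * normal_density 0 2 t * normal_density 0 2 y * indicator {0..<T / 4} u \<partial>lborel)"
    unfolding moved_def
  proof (rule integral_abs_bound_integral)
    let ?h = "\<lambda>t. H0 * normal_density 0 2 t * normal_density 0 2 y * indicator {0..<T / 4} u"
    show h: "integrable lborel ?h" by simp
    show "\<bar>std_normal_density t * tail t y * chi t u\<bar> \<le> ?h t" for t by (rule abs_kernel_le)
    then show "integrable lborel (\<lambda>t. std_normal_density t * tail t y * chi t u)"
      by (intro Bochner_Integration.integrable_bound[OF h]) (auto intro: order_trans[OF _ abs_ge_self])
  qed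
  also have "\<dots> = H0 * normal_density 0 2 y * indicator {0..<T / 4} u"
    by simp
  finally show ?thesis .
qed

lemma abs_moved_div_le:
  "\<bar>moved u y / std_normal_density u\<bar> \<le> eps / 2 * normal_density 0 2 y * indicator {0..<T / 4} u"
proof (cases "u \<in> {0..<T / 4}")
  case True
  have std: "exp (- T\<^sup>2 / 8) / 6 \<le> std_normal_density u"
  proof -
    have "u\<^sup>2 \<le> (T / 4)\<^sup>2" using True by (intro power_mono) auto
    then have "16 * u\<^sup>2 \<le> T\<^sup>2" by (simp add: power_divide)
    then have "- T\<^sup>2 / 8 \<le> - u\<^sup>2 / 2" using zero_le_power2[of u] by linarith
    then have "exp (- T\<^sup>2 / 8) \<le> exp (- u\<^sup>2 / 2)" by simp
    moreover have "sqrt (2 * pi) \<le> 6"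
      using pi_less_4 by (intro real_le_lsqrt) auto
    moreover have "0 < sqrt (2 * pi)" by simp
    ultimately show ?thesis
      unfolding std_normal_density_def times_divide_eq_left mult_1
      by (intro frac_le) auto
  qed
  have "\<bar>moved u y / std_normal_density u\<bar> = \<bar>moved u y\<bar> / std_normal_density u"
    by (simp add: abs_divide)
  also have "\<dots> \<le> (H0 * normal_density 0 2 y) / (exp (- T\<^sup>2 / 8) / 6)"
    using abs_moved_le[of u y] True std eps by (intro frac_le) (auto simp: H0_def)
  also have "\<dots> = eps / 2 * normal_density 0 2 y" by (simp add: H0_def)
  finally show ?thesis using True by simp
next
  case False
  then show ?thesis using abs_moved_le[of u y] by simp
qed

lemma dev_inside: "\<bar>t\<bar> \<le> T \<Longrightarrow> \<bar>dev t y\<bar> \<le> eps / 2 * normal_density 0 2 y"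
  using order_trans[OF abs_moved_div_le[of t y], of "eps / 2 * normal_density 0 2 y"] eps
  by (auto simp: dev_def tail_def indicator_def)

lemma dev_outside:
  "T < \<bar>t\<bar> \<Longrightarrow> dev t y = normal_density (\<kappa> * t) 1 y - normal_density 0 1 y"
proof -
  assume t: "T < \<bar>t\<bar>"
  then have "t \<notin> {0..<T / 4}" using T by auto
  then have "indicator {0..<T / 4} t = (0::real)" by (rule indicator_simps(2))
  with abs_moved_div_le[of t y] have "\<bar>moved t y / std_normal_density t\<bar> \<le> 0"
    by (simp only: mult_zero_right)
  then have "moved t y / std_normal_density t = 0" by (simp only: abs_le_zero_iff)
  with t show ?thesis by (simp add: dev_def tail_def)
qed

text \<open>The growth rate 1 / 8 is what the second moments can afford: a product of two deviations
  then grows like exp (t^2 / 4), still integrable against the Gaussian. The factor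
  \<open>eps\<close> is kept because it cancels in \<open>abs_score_le\<close>.\<close>

lemma abs_dev_le: "\<bar>dev t y\<bar> \<le> eps * exp (t\<^sup>2 / 8) * normal_density 0 2 y"
proof (cases "\<bar>t\<bar> \<le> T")
  case True
  have "eps / 2 * normal_density 0 2 y \<le> eps * exp (t\<^sup>2 / 8) * normal_density 0 2 y"
  proof (rule mult_right_mono)
    have "eps * 1 \<le> eps * exp (t\<^sup>2 / 8)" using eps by (intro mult_left_mono) auto
    then show "eps / 2 \<le> eps * exp (t\<^sup>2 / 8)" using eps by linarith
  qed simp
  with dev_inside[OF True] show ?thesis by (rule order_trans)
next
  case False
  have "2 * \<kappa> * \<bar>t\<bar> \<le> eps * exp (t\<^sup>2 / 16)"
  proof -
    have "6 * \<kappa> * 8 \<le> 6 * \<kappa> * T" using T_ge \<kappa>_pos by (intro mult_left_mono) auto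
    then have "48 * \<kappa> \<le> eps" using \<kappa>T by simp
    then have "2 * \<kappa> * \<bar>t\<bar> \<le> eps / 2 * \<bar>t\<bar>" using \<kappa>_pos by (intro mult_right_mono) auto
    also have "\<bar>t\<bar> \<le> 2 * exp (t\<^sup>2 / 16)"
      using abs_le_exp_sq_div_4[of "t / 2"] by (simp add: power_divide)
    finally show ?thesis using eps by (simp add: mult_left_mono)
  qed
  then have "2 * \<kappa> * \<bar>t\<bar> * exp (t\<^sup>2 / 16) * normal_density 0 2 y \<le> eps * exp (t\<^sup>2 / 16) * exp (t\<^sup>2 / 16) * normal_density 0 2 y"
    by (intro mult_right_mono) auto
  also have "\<dots> = eps * exp (t\<^sup>2 / 8) * normal_density 0 2 y"
    by (simp add: mult.assoc flip: exp_add)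
  finally show ?thesis using abs_tail_le[of t y] False dev_outside[of t y] by (simp add: tail_def)
qed

lemma integral_tail: "(\<integral>y. tail t y \<partial>lborel) = 0"
  by (cases "\<bar>t\<bar> \<le> T") (simp_all add: tail_def)

text \<open>Needed so that altering the contamination by \<open>dev\<close> preserves its total mass
  for every t. The tail is a difference of probability densities in y, and transport in t does not
  disturb this.\<close>

lemma integral_dev: "integrable lborel (dev t)" "(\<integral>y. dev t y \<partial>lborel) = 0"
proof -
  have le: "\<bar>std_normal_density x * tail x y * chi x t\<bar> \<le> (H0 * normal_density 0 2 x) * normal_density 0 2 y" for x y
  proof -
    have "H0 * normal_density 0 2 x * normal_density 0 2 y * indicator {0..<T / 4} t
        \<le> H0 * normal_density 0 2 x * normal_density 0 2 y * 1"
      using eps by (intro mult_left_mono) (auto simp: H0_def indicator_def)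
    with abs_kernel_le[of x y t] show ?thesis by simp
  qed
  note sw = integral_swap_dominated[where F = "\<lambda>x y. std_normal_density x * tail x y * chi x t", OF _ _ _ le]
  have "(\<integral>y. moved t y \<partial>lborel) = (\<integral>x. (\<integral>y. std_normal_density x * tail x y * chi x t \<partial>lborel) \<partial>lborel)"
    unfolding moved_def by (rule sw(1)[symmetric]) auto
  also have "\<dots> = (\<integral>x. std_normal_density x * (\<integral>y. tail x y \<partial>lborel) * chi x t \<partial>lborel)"
    by (simp only: integral_mult_left_zero integral_mult_right_zero)
  finally have 0: "(\<integral>y. moved t y \<partial>lborel) = 0" by (simp add: integral_tail)
  have i: "integrable lborel (moved t)"
    unfolding moved_def by (rule sw(3)) auto
  have "integrable lborel (tail t)" by (cases "\<bar>t\<bar> \<le> T") (simp_all add: tail_def[abs_def])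
  with i 0 show "integrable lborel (dev t)" "(\<integral>y. dev t y \<partial>lborel) = 0"
    unfolding dev_def by (auto simp: integral_tail)
qed

text \<open>The division by the Gaussian density in \<open>dev\<close> cancels the weight, leaving
  the moments of the weighted tail minus those of \<open>moved\<close>. After exchanging the
  integrals, \<open>chi_moment\<close> replaces u^j by t^j and the two agree, separately for each
  y.\<close>

lemma dev_moment:
  assumes j: "j \<le> m"
  shows "(\<integral>t. std_normal_density t * dev t y * t ^ j \<partial>lborel) = 0"
proof -
  have le: "\<bar>std_normal_density t * tail t y * chi t u * u ^ j\<bar>
      \<le> (H0 * normal_density 0 2 y * normal_density 0 2 t) * ((T / 4) ^ j * indicator {0..<T / 4} u)" for t u
  proof -
    have "\<bar>std_normal_density t * tail t y * chi t u * u ^ j\<bar>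
        = \<bar>std_normal_density t * tail t y * chi t u\<bar> * \<bar>u\<bar> ^ j"
      by (simp add: abs_mult power_abs)
    also have "\<dots> \<le> (H0 * normal_density 0 2 t * normal_density 0 2 y * indicator {0..<T / 4} u) * \<bar>u\<bar> ^ j"
      by (intro mult_right_mono abs_kernel_le) auto
    also have "\<dots> \<le> (H0 * normal_density 0 2 t * normal_density 0 2 y) * ((T / 4) ^ j * indicator {0..<T / 4} u)"
      using eps by (cases "u \<in> {0..<T / 4}")
        (auto simp: H0_def mult.assoc intro!: mult_left_mono power_mono)
    finally show ?thesis by (simp add: mult_ac)
  qed
  note sw = integral_swap_dominated[where F = "\<lambda>t u. std_normal_density t * tail t y * chi t u * u ^ j", OF _ _ _ le]
  have A: "(\<integral>u. std_normal_density t * tail t y * chi t u * u ^ j \<partial>lborel) = std_normal_density t * tail t y * t ^ j" for t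
    using chi_moment[OF j, of t] by (simp only: mult.assoc integral_mult_right_zero)
  have B: "(\<integral>t. std_normal_density t * tail t y * chi t u * u ^ j \<partial>lborel) = moved u y * u ^ j" for u
    unfolding moved_def by (rule integral_mult_left_zero)
  have ind: "integrable lborel (indicator {0..<T / 4} :: real \<Rightarrow> real)"
    using T by (intro integrable_real_indicator) auto
  have int: "integrable lborel (\<lambda>t. std_normal_density t * tail t y * t ^ j)"
    unfolding A[symmetric] using ind by (intro sw(2)) auto
  have int': "integrable lborel (\<lambda>u. moved u y * u ^ j)"
    unfolding B[symmetric] using ind by (intro sw(3)) auto
  have "(\<integral>t. std_normal_density t * tail t y * t ^ j \<partial>lborel) = (\<integral>u. moved u y * u ^ j \<partial>lborel)"
    unfolding A[symmetric] B[symmetric] using ind by (intro sw(1)) auto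
  moreover have "std_normal_density t * dev t y * t ^ j = std_normal_density t * tail t y * t ^ j - moved t y * t ^ j" for t
    using normal_density_pos[of 1 0 t] by (simp add: dev_def field_simps)
  ultimately show ?thesis using int int' by simp
qed

section \<open>The contaminating density and the likelihood ratio\<close>

definition resp :: "real \<Rightarrow> real" where
  "resp y = (1 - eps) * normal_density 0 1 y + eps * normal_density 0 2 y"

text \<open>Obtained by solving for the contamination: the mixture with
  N(\<open>\<kappa> * t\<close>, 1) has to be \<open>resp y + (1 - eps) * dev t y\<close>. For |t| >
  T the bracket vanishes and the default widened Gaussian remains.\<close>

definition contam :: "real \<Rightarrow> real \<Rightarrow> real" where
  "contam t y = normal_density 0 2 y + (1 - eps) / eps * (dev t y - (normal_density (\<kappa> * t) 1 y - normal_density 0 1 y))"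

definition score :: "real \<Rightarrow> real \<Rightarrow> real" where
  "score t y = (1 - eps) * dev t y / resp y"

lemma measurable_resp[measurable]: "resp \<in> borel_measurable borel"
  unfolding resp_def by measurable

lemma measurable_contam[measurable (raw)]:
  assumes [measurable]: "f \<in> borel_measurable M" "g \<in> borel_measurable M"
  shows "(\<lambda>x. contam (f x) (g x)) \<in> borel_measurable M"
  unfolding contam_def normal_density_shift[of "\<kappa> * _"] by measurable

lemma measurable_score[measurable (raw)]:
  assumes [measurable]: "f \<in> borel_measurable M" "g \<in> borel_measurable M"
  shows "(\<lambda>x. score (f x) (g x)) \<in> borel_measurable M"
  unfolding score_def by measurable

lemma resp_pos: "0 < resp y"
  using eps normal_density_pos[of 1 0 y] normal_density_pos[of 2 0 y] by (simp add: resp_def add_pos_pos)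

lemma resp_integral: "integrable lborel resp" "(\<integral>y. resp y \<partial>lborel) = 1"
  unfolding resp_def by (auto simp: algebra_simps)

lemma contam_integral: "integrable lborel (contam t)" "(\<integral>y. contam t y \<partial>lborel) = 1"
  unfolding contam_def using integral_dev[of t] by auto

text \<open>Inside [-T, T] the shift is at most eps / 6, so hiding it costs at most 2 (eps / 6) (3 /
  2) = eps / 2 times the widened Gaussian, and \<open>dev_inside\<close> costs the other half. This
  fixes the constant in \<open>6 * \<kappa> * T = eps\<close>.\<close>

lemma contam_nonneg: "0 \<le> contam t y"
proof (cases "\<bar>t\<bar> \<le> T")
  case False
  then show ?thesis by (simp add: contam_def dev_outside)
next
  case True
  let ?d = "normal_density (\<kappa> * t) 1 y - normal_density 0 1 y" and ?G = "normal_density 0 2 y"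
  have "\<bar>\<kappa> * t\<bar> \<le> eps / 6"
  proof -
    have "\<kappa> * \<bar>t\<bar> \<le> \<kappa> * T" using True \<kappa>_pos by (intro mult_left_mono) auto
    then show ?thesis using \<kappa>_pos unfolding \<kappa>T[symmetric] by (simp add: abs_mult)
  qed
  moreover have "exp ((\<kappa> * t)\<^sup>2 / 4) \<le> 3 / 2"
  proof -
    have "\<bar>\<kappa> * t\<bar> \<le> 1 / 12" using \<open>\<bar>\<kappa> * t\<bar> \<le> eps / 6\<close> eps by simp
    then have "(\<kappa> * t)\<^sup>2 \<le> (1 / 12)\<^sup>2" by (intro abs_le_square_iff[THEN iffD1]) auto
    also have "(1 / 12)\<^sup>2 \<le> (1::real)" by (simp add: power2_eq_square)
    finally have "(\<kappa> * t)\<^sup>2 / 4 \<le> 1 / 4" by simp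
    then have "exp ((\<kappa> * t)\<^sup>2 / 4) \<le> exp (1 / 4)" by simp
    also have "\<dots> \<le> 1 + 1 / 4 + (1 / 4)\<^sup>2" by (rule exp_bound) auto
    also have "\<dots> \<le> (3 / 2 :: real)" by (simp add: power2_eq_square)
    finally show ?thesis .
  qed
  ultimately have "2 * \<bar>\<kappa> * t\<bar> * exp ((\<kappa> * t)\<^sup>2 / 4) * ?G \<le> 2 * (eps / 6) * (3 / 2) * ?G"
    using eps by (intro mult_right_mono mult_mono) auto
  with abs_normal_density_diff_le[of "\<kappa> * t" y] have "\<bar>?d\<bar> \<le> eps / 2 * ?G" by simp
  with dev_inside[OF True, of y] have "\<bar>dev t y - ?d\<bar> \<le> eps * ?G"
    unfolding abs_le_iff by linarith
  then have "(1 - eps) / eps * \<bar>dev t y - ?d\<bar> \<le> (1 - eps) / eps * (eps * ?G)"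
    using eps by (intro mult_left_mono) auto
  also have "\<dots> \<le> ?G" using eps by (simp add: mult_left_le_one_le)
  finally have "\<bar>(1 - eps) / eps * (dev t y - ?d)\<bar> \<le> ?G" using eps by (simp add: abs_mult)
  from abs_le_D2[OF this] show ?thesis unfolding contam_def by linarith
qed

lemma mixture_eq:
  "(1 - eps) * normal_density (\<kappa> * t) 1 y + eps * contam t y = resp y * (1 + score t y)"
proof -
  have "eps * contam t y = eps * normal_density 0 2 y + (1 - eps) * (dev t y - (normal_density (\<kappa> * t) 1 y - normal_density 0 1 y))"
    using eps by (simp add: contam_def distrib_left)
  moreover have "resp y * (1 + score t y) = resp y + (1 - eps) * dev t y"
    using resp_pos[of y] by (simp add: score_def distrib_left)
  ultimately show ?thesis by (simp add: resp_def algebra_simps)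
qed

text \<open>The contaminated part of \<open>resp\<close> alone is \<open>eps\<close> times the
  widened Gaussian, and it cancels both from the bound on \<open>dev\<close>. The result is uniform
  in y and in \<open>eps\<close>.\<close>

lemma abs_score_le: "\<bar>score t y\<bar> \<le> exp (t\<^sup>2 / 8)"
proof -
  have "\<bar>score t y\<bar> = (1 - eps) * \<bar>dev t y\<bar> / resp y"
    using eps resp_pos[of y] by (simp add: score_def abs_mult abs_divide)
  also have "\<dots> \<le> (1 * (eps * exp (t\<^sup>2 / 8) * normal_density 0 2 y)) / (eps * normal_density 0 2 y)"
    using eps abs_dev_le[of t y] normal_density_pos[of 2 0 y]
    by (intro frac_le mult_mono) (auto simp: resp_def)
  also have "\<dots> = exp (t\<^sup>2 / 8)"
    using eps normal_density_pos[of 2 0 y] by simp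
  finally show ?thesis .
qed

lemma score_moment:
  assumes "j \<le> m"
  shows "(\<integral>t. std_normal_density t * score t y * t ^ j \<partial>lborel) = 0"
proof -
  have "(\<integral>t. std_normal_density t * score t y * t ^ j \<partial>lborel)
      = (\<integral>t. (1 - eps) / resp y * (std_normal_density t * dev t y * t ^ j) \<partial>lborel)"
    by (intro Bochner_Integration.integral_cong) (auto simp: score_def)
  then show ?thesis using dev_moment[OF assms, of y] by simp
qed

end

section \<open>Correlation decay for functions without low moments\<close>

lemma std_normal_exp_quarter:
  "integrable lborel (\<lambda>u. std_normal_density u * exp (u\<^sup>2 / 4))"
  "(\<integral>u. std_normal_density u * exp (u\<^sup>2 / 4) \<partial>lborel) = sqrt 2"
proof -
  have "std_normal_density u * exp (u\<^sup>2 / 4) = sqrt 2 * normal_density 0 (sqrt 2) u" for u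
    unfolding normal_density_def real_sqrt_mult[of "2 * pi" "(sqrt 2)\<^sup>2"] real_sqrt_abs
    by (simp flip: exp_add)
  then show "integrable lborel (\<lambda>u. std_normal_density u * exp (u\<^sup>2 / 4))"
    "(\<integral>u. std_normal_density u * exp (u\<^sup>2 / 4) \<partial>lborel) = sqrt 2"
    by simp_all
qed

lemma integrable_std_normal_subgaussian:
  assumes [measurable]: "F \<in> borel_measurable borel" and F: "\<And>t. \<bar>F t\<bar> \<le> exp (t\<^sup>2 / 8)"
  shows "integrable lborel (\<lambda>u. std_normal_density u * F u * u ^ j)"
proof (rule Bochner_Integration.integrable_bound)
  show "integrable lborel (\<lambda>u. 2 * (normal_density 0 2 u * \<bar>u\<bar> ^ j))"
    using integrable_normal_moment_abs[of 2 0 j] by simp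
  have "\<bar>std_normal_density u * F u * u ^ j\<bar> \<le> 2 * (normal_density 0 2 u * \<bar>u\<bar> ^ j)" for u
  proof -
    have "\<bar>std_normal_density u * F u * u ^ j\<bar> = std_normal_density u * \<bar>F u\<bar> * \<bar>u\<bar> ^ j"
      by (simp add: abs_mult power_abs)
    also have "\<dots> \<le> std_normal_density u * exp (u\<^sup>2 / 8) * \<bar>u\<bar> ^ j"
      by (intro mult_mono F) auto
    also have "std_normal_density u * exp (u\<^sup>2 / 8) = 1 / sqrt (2 * pi) * exp (- 3 * u\<^sup>2 / 8)"
      by (simp add: std_normal_density_def flip: exp_add)
    also have "\<dots> * \<bar>u\<bar> ^ j \<le> 1 / sqrt (2 * pi) * exp (- u\<^sup>2 / 8) * \<bar>u\<bar> ^ j"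
      by (intro mult_right_mono mult_left_mono) auto
    also have "1 / sqrt (2 * pi) * exp (- u\<^sup>2 / 8) = 2 * normal_density 0 2 u"
      by (simp add: normal_density_0_2)
    finally show ?thesis by simp
  qed
  then show "AE u in lborel. norm (std_normal_density u * F u * u ^ j) \<le> norm (2 * (normal_density 0 2 u * \<bar>u\<bar> ^ j))"
    by (auto intro: order_trans[OF _ abs_ge_self])
qed measurable

lemma integral_std_normal_poly_eq_0:
  assumes [measurable]: "F \<in> borel_measurable borel" and F: "\<And>t. \<bar>F t\<bar> \<le> exp (t\<^sup>2 / 8)"
    and mom: "\<And>j. j \<le> m \<Longrightarrow> (\<integral>t. std_normal_density t * F t * t ^ j \<partial>lborel) = 0"
    and p: "degree p \<le> m"
  shows "integrable lborel (\<lambda>u. std_normal_density u * F u * poly p u)"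
    "(\<integral>u. std_normal_density u * F u * poly p u \<partial>lborel) = 0"
proof -
  have eq: "std_normal_density u * F u * poly p u =
      (\<Sum>j\<le>degree p. coeff p j * (std_normal_density u * F u * u ^ j))" for u
    by (simp add: poly_altdef sum_distrib_left mult_ac)
  have i: "integrable lborel (\<lambda>u. std_normal_density u * F u * u ^ j)" for j
    by (rule integrable_std_normal_subgaussian[OF _ F]) measurable
  show "integrable lborel (\<lambda>u. std_normal_density u * F u * poly p u)"
    unfolding eq using i by simp
  show "(\<integral>u. std_normal_density u * F u * poly p u \<partial>lborel) = 0"
    unfolding eq using i mom p by (simp add: Bochner_Integration.integral_sum)
qed

lemma exp_taylor_remainder:
  fixes x :: real
  shows "\<bar>exp x - (\<Sum>i<n. x ^ i / fact i)\<bar> \<le> \<bar>x\<bar> ^ n / fact n * exp \<bar>x\<bar>"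
proof -
  obtain t where t: "\<bar>t\<bar> \<le> \<bar>x\<bar>" "exp x = (\<Sum>m<n. (x ^ m) / fact m) + (exp t / fact n) * x ^ n"
    using Maclaurin_exp_le[of x n] by blast
  have "\<bar>exp x - (\<Sum>i<n. x ^ i / fact i)\<bar> = exp t * (\<bar>x\<bar> ^ n / fact n)"
    unfolding t(2) by (simp add: abs_mult power_abs)
  also have "\<dots> \<le> exp \<bar>x\<bar> * (\<bar>x\<bar> ^ n / fact n)"
    using t(1) by (intro mult_right_mono) auto
  finally show ?thesis by (simp add: mult.commute)
qed

text \<open>Substitution u = r z + s w. The weight is the density of N(r z, s^2) relative to N(0,
  1), that is, the Mehler kernel of the Ornstein-Uhlenbeck smoothing with correlation r.\<close>

lemma integral_std_normal_affine:
  fixes F :: "real \<Rightarrow> real"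
  assumes s: "0 < s" "r\<^sup>2 + s\<^sup>2 = 1"
  shows "(\<integral>w. std_normal_density w * F (r * z + s * w) \<partial>lborel) =
    (\<integral>u. std_normal_density u * F u *
      (1 / s * exp (- (r\<^sup>2 * z\<^sup>2) / (2 * s\<^sup>2)) * exp ((2 * r * z * u - r\<^sup>2 * u\<^sup>2) / (2 * s\<^sup>2))) \<partial>lborel)"
proof -
  \<comment> \<open>With u = r z + s w and r^2 + s^2 = 1 the numerator over 2 s^2 collapses to - (u
    - r z)^2 = - (s w)^2.\<close>
  have e: "- (r * z + s * w)\<^sup>2 / 2 + - (r\<^sup>2 * z\<^sup>2) / (2 * s\<^sup>2) + (2 * r * z * (r * z + s * w) - r\<^sup>2 * (r * z + s * w)\<^sup>2) / (2 * s\<^sup>2)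
      = - w\<^sup>2 / 2" for w
  proof -
    have "- (r * z + s * w)\<^sup>2 * s\<^sup>2 - r\<^sup>2 * z\<^sup>2 + 2 * r * z * (r * z + s * w) - r\<^sup>2 * (r * z + s * w)\<^sup>2
      = 2 * r * z * (r * z + s * w) - r\<^sup>2 * z\<^sup>2 - (r * z + s * w)\<^sup>2 * (r\<^sup>2 + s\<^sup>2)"
      by (simp add: algebra_simps)
    also have "\<dots> = - w\<^sup>2 * s\<^sup>2"
      unfolding s(2) by (simp add: power2_eq_square algebra_simps)
    finally have "(- (r * z + s * w)\<^sup>2 * s\<^sup>2 - r\<^sup>2 * z\<^sup>2 + 2 * r * z * (r * z + s * w) - r\<^sup>2 * (r * z + s * w)\<^sup>2) / (2 * s\<^sup>2)
        = - w\<^sup>2 * s\<^sup>2 / (2 * s\<^sup>2)" by simp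
    then show ?thesis using s(1) by (simp add: add_divide_distrib diff_divide_distrib)
  qed
  let ?f = "\<lambda>u. std_normal_density u * F u *
      (1 / s * exp (- (r\<^sup>2 * z\<^sup>2) / (2 * s\<^sup>2)) * exp ((2 * r * z * u - r\<^sup>2 * u\<^sup>2) / (2 * s\<^sup>2)))"
  have "s * ?f (r * z + s * w) = std_normal_density w * F (r * z + s * w)" for w
  proof -
    have "s * ?f (r * z + s * w) = 1 / sqrt (2 * pi) * F (r * z + s * w) *
      exp (- (r * z + s * w)\<^sup>2 / 2 + - (r\<^sup>2 * z\<^sup>2) / (2 * s\<^sup>2) + (2 * r * z * (r * z + s * w) - r\<^sup>2 * (r * z + s * w)\<^sup>2) / (2 * s\<^sup>2))"
      unfolding exp_add using s(1) by (simp add: std_normal_density_def)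
    then show ?thesis unfolding e by (simp add: std_normal_density_def)
  qed
  then have "(\<integral>w. std_normal_density w * F (r * z + s * w) \<partial>lborel) = (\<integral>w. s * ?f (r * z + s * w) \<partial>lborel)"
    by simp
  also have "\<dots> = s * (\<integral>w. ?f (r * z + s * w) \<partial>lborel)"
    by (rule integral_mult_right_zero)
  also have "\<dots> = (\<integral>u. ?f u \<partial>lborel)"
    using s(1) lborel_integral_real_affine[of s ?f "r * z"] by (simp only: abs_of_pos real_scaleR_def)
  finally show ?thesis .
qed

text \<open>
  The smoothing kernel is, up to a constant factor, \<open>exp q\<close> with \<open>q\<close> quadratic in \<open>u\<close> and of size
  \<open>r\<close>, so the vanishing moments remove its Taylor polynomial and leave a remainder of order
  \<open>r ^ (M + 1)\<close>.
\<close>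

lemma abs_smoothed_le:
  assumes F_meas[measurable]: "F \<in> borel_measurable borel" and F: "\<And>t. \<bar>F t\<bar> \<le> exp (t\<^sup>2 / 8)"
    and mom: "\<And>j. j \<le> 2 * M \<Longrightarrow> (\<integral>t. std_normal_density t * F t * t ^ j \<partial>lborel) = 0"
    and r: "0 \<le> r" "r \<le> 1 / 16" and s: "0 < s" "r\<^sup>2 + s\<^sup>2 = 1"
  shows "\<bar>\<integral>w. std_normal_density w * F (r * z + s * w) \<partial>lborel\<bar> \<le> 2 * sqrt 2 * (16 * r) ^ Suc M * exp (z\<^sup>2 / 8)"
proof -
  define c where "c = 1 / s * exp (- (r\<^sup>2 * z\<^sup>2) / (2 * s\<^sup>2))"
  define q where "q u = (2 * r * z * u - r\<^sup>2 * u\<^sup>2) / (2 * s\<^sup>2)" for u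
  \<comment> \<open>Taylor polynomial of exp of degree M, composed with the quadratic q: its degree
    in u is at most 2 M, which is why that many moments are assumed to vanish.\<close>
  define p where "p = (\<Sum>i<Suc M. smult (1 / fact i) ([:0, r * z / s\<^sup>2, - (r\<^sup>2 / (2 * s\<^sup>2)):] ^ i))"
  have [measurable]: "q \<in> borel_measurable borel" unfolding q_def by measurable
  have r2: "r\<^sup>2 \<le> 1 / 256" using power_mono[OF r(2,1), of 2] by (simp add: power_divide)
  have s_ge: "1 / 2 \<le> s"
  proof (rule ccontr)
    assume "\<not> 1 / 2 \<le> s"
    then have "s\<^sup>2 \<le> (1 / 2)\<^sup>2" using s by (intro power_mono) auto
    then show False using s r2 by (simp add: power_divide)
  qed
  have c: "0 \<le> c" "c \<le> 2"
  proof -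
    have "1 / s \<le> 2" using s_ge by (simp add: field_simps)
    moreover have "exp (- (r\<^sup>2 * z\<^sup>2) / (2 * s\<^sup>2)) \<le> 1" by simp
    ultimately have "c \<le> 2 * 1" unfolding c_def using s by (intro mult_mono) auto
    then show "0 \<le> c" "c \<le> 2" using s by (auto simp: c_def)
  qed
  have pq: "poly [:0, r * z / s\<^sup>2, - (r\<^sup>2 / (2 * s\<^sup>2)):] u = q u" for u
    using s(1) by (simp add: q_def field_simps power2_eq_square)
  have p_eq: "poly p u = (\<Sum>i<Suc M. q u ^ i / fact i)" for u
    unfolding p_def poly_sum poly_smult poly_power pq by simp
  have "degree ([:0, r * z / s\<^sup>2, - (r\<^sup>2 / (2 * s\<^sup>2)):] ^ i) \<le> 2 * M" if "i < Suc M" for i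
    by (rule order_trans[OF degree_power_le]) (use that in auto)
  then have deg: "degree p \<le> 2 * M"
    unfolding p_def
    by (intro degree_sum_le) (auto intro!: order_trans[OF degree_smult_le])
  note poly0 = integral_std_normal_poly_eq_0[OF F_meas F mom deg]
  have abs_q: "\<bar>q u\<bar> \<le> r * (z\<^sup>2 + u\<^sup>2)" for u
  proof -
    have "\<bar>2 * r * z * u - r\<^sup>2 * u\<^sup>2\<bar> \<le> \<bar>2 * r * z * u\<bar> + \<bar>r\<^sup>2 * u\<^sup>2\<bar>" by (rule abs_triangle_ineq4)
    also have "\<bar>2 * r * z * u\<bar> = r * (2 * \<bar>z\<bar> * \<bar>u\<bar>)" using r by (simp add: abs_mult)
    also have "2 * \<bar>z\<bar> * \<bar>u\<bar> \<le> z\<^sup>2 + u\<^sup>2"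
      using zero_le_power2[of "\<bar>z\<bar> - \<bar>u\<bar>"] by (simp add: power2_diff)
    also have "\<bar>r\<^sup>2 * u\<^sup>2\<bar> = r * (r * u\<^sup>2)" by (simp add: power2_eq_square)
    also have "r * u\<^sup>2 \<le> 1 / 16 * (z\<^sup>2 + u\<^sup>2)" using r by (intro mult_mono) auto
    finally have "\<bar>2 * r * z * u - r\<^sup>2 * u\<^sup>2\<bar> \<le> r * (z\<^sup>2 + u\<^sup>2) + r * (1 / 16 * (z\<^sup>2 + u\<^sup>2))"
      using r by (simp add: mult_left_mono)
    also have "\<dots> = r * (z\<^sup>2 + u\<^sup>2) * (17 / 16)" by (simp add: algebra_simps)
    also have "\<dots> \<le> r * (z\<^sup>2 + u\<^sup>2) * (2 * s\<^sup>2)" using s r2 r by (intro mult_left_mono) auto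
    finally show ?thesis using s by (simp add: q_def abs_divide pos_divide_le_eq)
  qed
  have rem: "\<bar>exp (q u) - poly p u\<bar> \<le> (16 * r) ^ Suc M * exp (z\<^sup>2 / 8) * exp (u\<^sup>2 / 8)" for u
  proof -
    let ?S = "z\<^sup>2 + u\<^sup>2"
    have "\<bar>exp (q u) - poly p u\<bar> \<le> \<bar>q u\<bar> ^ Suc M / fact (Suc M) * exp \<bar>q u\<bar>"
      unfolding p_eq by (rule exp_taylor_remainder)
    also have "\<dots> \<le> (r * ?S) ^ Suc M / fact (Suc M) * exp (1 / 16 * ?S)"
    proof (intro mult_mono divide_right_mono power_mono abs_q)
      have "r * ?S \<le> 1 / 16 * ?S" using r by (intro mult_right_mono) auto
      with abs_q[of u] show "exp \<bar>q u\<bar> \<le> exp (1 / 16 * ?S)" by simp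
    qed (use r in auto)
    \<comment> \<open>Shifting a factor 16 from S to r lets (S / 16)^(M + 1) / (M + 1)! be absorbed
      by exp (S / 16). Together with exp |q| this makes exp (S / 8), whose u-part combines with the
      growth of F to exp (u^2 / 4).\<close>
    also have "(r * ?S) ^ Suc M / fact (Suc M) = (16 * r) ^ Suc M * ((1 / 16 * ?S) ^ Suc M / fact (Suc M))"
    proof -
      have "r * ?S = (16 * r) * (1 / 16 * ?S)" by simp
      then show ?thesis by (simp only: times_divide_eq_right power_mult_distrib)
    qed
    also have "\<dots> \<le> (16 * r) ^ Suc M * exp (1 / 16 * ?S)"
      using r by (intro mult_left_mono power_div_fact_le_exp) auto
    finally have "\<bar>exp (q u) - poly p u\<bar> \<le> (16 * r) ^ Suc M * exp (1 / 16 * ?S) * exp (1 / 16 * ?S)"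
      by simp
    also have "\<dots> = (16 * r) ^ Suc M * exp (z\<^sup>2 / 8) * exp (u\<^sup>2 / 8)"
      by (simp only: mult.assoc exp_add[symmetric]) simp
    finally show ?thesis .
  qed
  let ?K = "2 * (16 * r) ^ Suc M * exp (z\<^sup>2 / 8)"
  have bd: "\<bar>std_normal_density u * F u * (c * (exp (q u) - poly p u))\<bar> \<le> ?K * (std_normal_density u * exp (u\<^sup>2 / 4))" for u
  proof -
    have "\<bar>std_normal_density u * F u * (c * (exp (q u) - poly p u))\<bar>
        = std_normal_density u * \<bar>F u\<bar> * (c * \<bar>exp (q u) - poly p u\<bar>)"
      using c by (simp add: abs_mult)
    also have "\<dots> \<le> std_normal_density u * exp (u\<^sup>2 / 8) * (2 * ((16 * r) ^ Suc M * exp (z\<^sup>2 / 8) * exp (u\<^sup>2 / 8)))"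
      using c r by (intro mult_mono F rem) auto
    also have "\<dots> = ?K * (std_normal_density u * (exp (u\<^sup>2 / 8) * exp (u\<^sup>2 / 8)))"
      by simp
    also have "exp (u\<^sup>2 / 8) * exp (u\<^sup>2 / 8) = exp (u\<^sup>2 / 4)" by (simp flip: exp_add)
    finally show ?thesis .
  qed
  have Kint: "integrable lborel (\<lambda>u. ?K * (std_normal_density u * exp (u\<^sup>2 / 4)))"
    using std_normal_exp_quarter(1) by (rule integrable_mult_right)
  have remint: "integrable lborel (\<lambda>u. std_normal_density u * F u * (c * (exp (q u) - poly p u)))"
    by (rule Bochner_Integration.integrable_bound[OF Kint])
      (use bd in \<open>auto intro: order_trans[OF _ abs_ge_self] simp: p_eq\<close>)
  have "(\<integral>w. std_normal_density w * F (r * z + s * w) \<partial>lborel) = (\<integral>u. std_normal_density u * F u * (c * exp (q u)) \<partial>lborel)"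
    unfolding integral_std_normal_affine[OF s] c_def q_def ..
  also have "\<dots> = (\<integral>u. std_normal_density u * F u * (c * (exp (q u) - poly p u)) + c * (std_normal_density u * F u * poly p u) \<partial>lborel)"
    by (intro Bochner_Integration.integral_cong refl) (simp add: algebra_simps)
  also have "\<dots> = (\<integral>u. std_normal_density u * F u * (c * (exp (q u) - poly p u)) \<partial>lborel)"
    using remint poly0 by simp
  finally have "\<bar>\<integral>w. std_normal_density w * F (r * z + s * w) \<partial>lborel\<bar> = \<bar>\<integral>u. std_normal_density u * F u * (c * (exp (q u) - poly p u)) \<partial>lborel\<bar>"
    by simp
  also have "\<dots> \<le> (\<integral>u. ?K * (std_normal_density u * exp (u\<^sup>2 / 4)) \<partial>lborel)"
    by (rule integral_abs_bound_integral[OF remint Kint bd])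
  also have "\<dots> = ?K * sqrt 2" using std_normal_exp_quarter(2) by simp
  finally show ?thesis by (simp only: mult_ac)
qed

text \<open>Squaring the pointwise bound gives 8 (256 r^2)^(M + 1) exp (z^2 / 4); the last factor
  has Gaussian integral sqrt 2 \<le> 3 / 2, whence 12.\<close>

lemma integral_smoothed_sq_le:
  assumes F_meas[measurable]: "F \<in> borel_measurable borel" and F: "\<And>t. \<bar>F t\<bar> \<le> exp (t\<^sup>2 / 8)"
    and mom: "\<And>j. j \<le> 2 * M \<Longrightarrow> (\<integral>t. std_normal_density t * F t * t ^ j \<partial>lborel) = 0"
    and r: "0 \<le> r" "r \<le> 1 / 16" and s: "0 < s" "r\<^sup>2 + s\<^sup>2 = 1"
  shows "(\<integral>z. std_normal_density z * (\<integral>w. std_normal_density w * F (r * z + s * w) \<partial>lborel)\<^sup>2 \<partial>lborel)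
    \<le> 12 * (256 * r\<^sup>2) ^ Suc M"
proof -
  let ?K = "8 * (256 * r\<^sup>2) ^ Suc M"
  have bd: "std_normal_density z * (\<integral>w. std_normal_density w * F (r * z + s * w) \<partial>lborel)\<^sup>2
      \<le> ?K * (std_normal_density z * exp (z\<^sup>2 / 4))" for z
  proof -
    have "(\<integral>w. std_normal_density w * F (r * z + s * w) \<partial>lborel)\<^sup>2 \<le> (2 * sqrt 2 * (16 * r) ^ Suc M * exp (z\<^sup>2 / 8))\<^sup>2"
      using abs_smoothed_le[OF F_meas F mom r s, where z = z] r by (intro power2_le_iff_abs_le[THEN iffD2]) auto
    also have "\<dots> = (2 * sqrt 2)\<^sup>2 * ((16 * r) ^ Suc M)\<^sup>2 * (exp (z\<^sup>2 / 8))\<^sup>2"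
      by (simp only: power_mult_distrib)
    also have "((16 * r) ^ Suc M)\<^sup>2 = ((16 * r)\<^sup>2) ^ Suc M" by (simp only: power_mult[symmetric] mult.commute)
    also have "(16 * r)\<^sup>2 = 256 * r\<^sup>2" by (simp add: power_mult_distrib)
    also have "(exp (z\<^sup>2 / 8))\<^sup>2 = exp (z\<^sup>2 / 4)" by (simp add: power2_eq_square flip: exp_add)
    also have "(2 * sqrt 2)\<^sup>2 = (8::real)" by (simp add: power_mult_distrib)
    finally show ?thesis by (simp add: mult_left_mono mult.left_commute)
  qed
  have Kint: "integrable lborel (\<lambda>u. ?K * (std_normal_density u * exp (u\<^sup>2 / 4)))"
    using std_normal_exp_quarter(1) by (rule integrable_mult_right)
  have "(\<integral>z. std_normal_density z * (\<integral>w. std_normal_density w * F (r * z + s * w) \<partial>lborel)\<^sup>2 \<partial>lborel)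
      \<le> (\<integral>u. ?K * (std_normal_density u * exp (u\<^sup>2 / 4)) \<partial>lborel)"
  proof (rule integral_mono[OF _ Kint bd])
    show "integrable lborel (\<lambda>z. std_normal_density z * (\<integral>w. std_normal_density w * F (r * z + s * w) \<partial>lborel)\<^sup>2)"
      by (rule Bochner_Integration.integrable_bound[OF Kint])
        (use bd in \<open>auto intro: order_trans[OF _ abs_ge_self]\<close>)
  qed
  also have "\<dots> = ?K * sqrt 2" using std_normal_exp_quarter(2) by simp
  also have "\<dots> \<le> ?K * (3 / 2)"
    using r by (intro mult_left_mono real_le_lsqrt) (auto simp: power_divide)
  also have "\<dots> = 12 * (256 * r\<^sup>2) ^ Suc M" by (simp del: power_Suc)
  finally show ?thesis .
qed

section \<open>Projections of a Gaussian vector\<close>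

abbreviation std_normal :: "real measure" where "std_normal \<equiv> normal_measure 0 1"

lemma sets_normal_measure[simp, measurable_cong]: "sets (normal_measure m s) = sets borel"
  by (simp add: normal_measure_def)

lemma space_normal_measure[simp]: "space (normal_measure m s) = UNIV"
  by (simp add: normal_measure_def)

lemma prob_space_normal_measure: "0 < s \<Longrightarrow> prob_space (normal_measure m s)"
  unfolding normal_measure_def by (rule prob_space_normal_density)

lemma integral_std_normal:
  fixes f :: "real \<Rightarrow> real"
  assumes [measurable]: "f \<in> borel_measurable borel"
  shows "(\<integral>z. f z \<partial>std_normal) = (\<integral>z. std_normal_density z * f z \<partial>lborel)"
    "integrable std_normal f \<longleftrightarrow> integrable lborel (\<lambda>z. std_normal_density z * f z)"
  unfolding normal_measure_def
  by (simp_all add: integral_density integrable_density)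

lemma sets_gaussian_vec[measurable_cong]: "sets (gaussian_vec p) = sets (vec_borel p)"
  unfolding gaussian_vec_def vec_borel_def by (rule sets_PiM_cong) auto

lemma space_gaussian_vec: "space (gaussian_vec p) = space (vec_borel p)"
  by (rule sets_eq_imp_space_eq) (rule sets_gaussian_vec)

lemma measurable_vec_component: "i < p \<Longrightarrow> (\<lambda>x. x i) \<in> borel_measurable (vec_borel p)"
  unfolding vec_borel_def by (rule measurable_component_singleton) auto

lemma prob_space_gaussian_vec: "prob_space (gaussian_vec p)"
  unfolding gaussian_vec_def by (intro prob_space_PiM prob_space_normal_measure) auto

lemma distr_gaussian_vec_component:
  "i < p \<Longrightarrow> distr (gaussian_vec p) borel (\<lambda>x. x i) = std_normal"
proof -
  assume i: "i < p"
  have "distr (gaussian_vec p) borel (\<lambda>x. x i) = distr (gaussian_vec p) std_normal (\<lambda>x. x i)"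
    by (rule distr_cong) auto
  also have "\<dots> = std_normal"
    unfolding gaussian_vec_def using i
    by (intro distr_PiM_component prob_space_normal_measure) auto
  finally show ?thesis .
qed

lemma indep_gaussian_vec_components:
  assumes "0 < p"
  shows "prob_space.indep_vars (gaussian_vec p) (\<lambda>_. borel) (\<lambda>i x. x i) {..<p}"
proof -
  interpret prob_space "gaussian_vec p" by (rule prob_space_gaussian_vec)
  have "distr (gaussian_vec p) (\<Pi>\<^sub>M i\<in>{..<p}. borel) (\<lambda>x. \<lambda>i\<in>{..<p}. x i)
      = distr (gaussian_vec p) (gaussian_vec p) (\<lambda>x. x)"
    by (rule distr_cong) (auto simp: sets_gaussian_vec space_gaussian_vec vec_borel_def space_PiM PiE_restrict)
  also have "\<dots> = gaussian_vec p" by (rule distr_id)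
  also have "\<dots> = (\<Pi>\<^sub>M i\<in>{..<p}. distr (gaussian_vec p) borel (\<lambda>x. x i))"
    unfolding gaussian_vec_def[of p] 
    by (intro PiM_cong refl) (auto simp: distr_gaussian_vec_component[unfolded gaussian_vec_def])
  finally show ?thesis
    using assms
    by (subst indep_vars_iff_distr_eq_PiM')
      (auto simp: measurable_cong_sets[OF sets_gaussian_vec refl] intro: measurable_vec_component)
qed

text \<open>Stated as an image law rather than by a density so that the empty set is covered, where
  the law is a point mass; two chosen sets may well be disjoint.\<close>

lemma distr_gaussian_vec_sum:
  assumes A: "A \<subseteq> {..<p}"
  shows "distr (gaussian_vec p) borel (\<lambda>x. \<Sum>i\<in>A. x i) = distr std_normal borel (\<lambda>z. sqrt (card A) * z)"
proof -
  interpret G: prob_space "gaussian_vec p" by (rule prob_space_gaussian_vec)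
  interpret N: prob_space std_normal by (rule prob_space_normal_measure) simp
  have fA: "finite A" using A finite_subset by auto
  show ?thesis
  proof (cases "A = {}")
    case True
    then show ?thesis using G.distr_const[of "0::real" borel] N.distr_const[of "0::real" borel] by simp
  next
    case False
    then have c: "0 < sqrt (card A)" using fA by (simp add: card_gt_0_iff)
    have p: "0 < p" using False A by auto
    have d: "distributed (gaussian_vec p) lborel (\<lambda>x. x i) (normal_density 0 1)" if "i \<in> A" for i
      using distr_gaussian_vec_component[of i p] that A
      unfolding distributed_def normal_measure_def
      by (auto simp: subset_iff intro!: measurable_vec_component[THEN measurable_compose] cong: distr_cong
           measurable_cong_sets[OF sets_gaussian_vec])
    have "distributed (gaussian_vec p) lborel (\<lambda>x. \<Sum>i\<in>A. x i) (normal_density (\<Sum>i\<in>A. 0) (sqrt (\<Sum>i\<in>A. 1\<^sup>2)))"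
      using fA False A d
      by (intro G.sum_indep_normal G.indep_vars_subset[OF indep_gaussian_vec_components[OF p]]) auto
    then have 1: "distr (gaussian_vec p) lborel (\<lambda>x. \<Sum>i\<in>A. x i) = density lborel (normal_density 0 (sqrt (card A)))"
      by (simp add: distributed_def)
    have "distributed std_normal lborel (\<lambda>z. z) (normal_density 0 1)"
      unfolding distributed_def by (auto simp: normal_measure_def intro!: distr_id2)
    then have "distributed std_normal lborel (\<lambda>z. 0 + sqrt (card A) * z) (normal_density (0 + sqrt (card A) * 0) (\<bar>sqrt (card A)\<bar> * 1))"
      using c by (intro N.normal_density_affine) auto
    then have 2: "distr std_normal lborel (\<lambda>z. sqrt (card A) * z) = density lborel (normal_density 0 (sqrt (card A)))"
      by (simp add: distributed_def)
    have "distr (gaussian_vec p) borel (\<lambda>x. \<Sum>i\<in>A. x i) = distr (gaussian_vec p) lborel (\<lambda>x. \<Sum>i\<in>A. x i)"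
      by (rule distr_cong) auto
    also have "\<dots> = distr std_normal lborel (\<lambda>z. sqrt (card A) * z)" unfolding 1 2 ..
    also have "\<dots> = distr std_normal borel (\<lambda>z. sqrt (card A) * z)" by (rule distr_cong) auto
    finally show ?thesis .
  qed
qed

definition proj :: "nat set \<Rightarrow> rvec \<Rightarrow> real" where
  "proj A x = (\<Sum>i\<in>A. x i) / sqrt (card A)"

lemma measurable_sum_components:
  "A \<subseteq> {..<p} \<Longrightarrow> (\<lambda>x. \<Sum>i\<in>A. x i) \<in> borel_measurable (vec_borel p)"
  by (rule borel_measurable_sum) (auto intro: measurable_vec_component)

lemma measurable_proj: "A \<subseteq> {..<p} \<Longrightarrow> proj A \<in> borel_measurable (vec_borel p)"
  unfolding proj_def by (intro borel_measurable_divide measurable_sum_components) auto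

lemma distr_proj:
  assumes A: "A \<subseteq> {..<p}" "A \<noteq> {}"
  shows "distr (gaussian_vec p) borel (proj A) = std_normal"
proof -
  have [measurable]: "(\<lambda>x. \<Sum>i\<in>A. x i) \<in> borel_measurable (gaussian_vec p)"
    using measurable_sum_components[OF A(1)] by (simp cong: measurable_cong_sets[OF sets_gaussian_vec])
  have c: "0 < sqrt (card A)" using A finite_subset[OF A(1)] by (simp add: card_gt_0_iff)
  have m: "(\<lambda>z. sqrt (card A) * z) \<in> borel_measurable std_normal" by measurable
  have "distr (gaussian_vec p) borel (proj A) = distr (distr (gaussian_vec p) borel (\<lambda>x. \<Sum>i\<in>A. x i)) borel (\<lambda>y. y / sqrt (card A))"
    by (subst distr_distr) (auto simp: proj_def[abs_def] comp_def)
  also have "\<dots> = distr std_normal borel (\<lambda>z. z)"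
    unfolding distr_gaussian_vec_sum[OF A(1)] using c m
    by (subst distr_distr) (auto simp: comp_def)
  also have "\<dots> = std_normal" by (rule distr_id2) simp
  finally show ?thesis .
qed

lemma integrable_exp_proj_sq:
  assumes A: "A \<subseteq> {..<p}" "A \<noteq> {}"
  shows "integrable (gaussian_vec p) (\<lambda>x. exp ((proj A x)\<^sup>2 / 4))"
    "(\<integral>x. exp ((proj A x)\<^sup>2 / 4) \<partial>gaussian_vec p) = sqrt 2"
proof -
  have [measurable]: "proj A \<in> borel_measurable (gaussian_vec p)"
    using measurable_proj[OF A(1)] by (simp cong: measurable_cong_sets[OF sets_gaussian_vec])
  have "integrable std_normal (\<lambda>z. exp (z\<^sup>2 / 4))" "(\<integral>z. exp (z\<^sup>2 / 4) \<partial>std_normal) = sqrt 2"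
    using std_normal_exp_quarter by (simp_all add: integral_std_normal)
  then show "integrable (gaussian_vec p) (\<lambda>x. exp ((proj A x)\<^sup>2 / 4))"
    "(\<integral>x. exp ((proj A x)\<^sup>2 / 4) \<partial>gaussian_vec p) = sqrt 2"
    unfolding distr_proj[OF A, symmetric] by (simp_all add: integrable_distr_eq integral_distr)
qed

text \<open>The majorant is a sum of functions of one projection each, so integrability of a product
  needs no joint law.\<close>

lemma abs_mult_subgaussian_le:
  fixes a b :: real
  assumes "\<bar>f\<bar> \<le> exp (a\<^sup>2 / 8)" "\<bar>g\<bar> \<le> exp (b\<^sup>2 / 8)"
  shows "\<bar>f * g\<bar> \<le> exp (a\<^sup>2 / 4) + exp (b\<^sup>2 / 4)"
proof -
  let ?a = "exp (a\<^sup>2 / 8)" and ?b = "exp (b\<^sup>2 / 8)"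
  have "\<bar>f * g\<bar> \<le> ?a * ?b" unfolding abs_mult using assms by (intro mult_mono) auto
  also have "\<dots> \<le> ?a * ?a + ?b * ?b"
    using zero_le_power2[of "?a - ?b"] mult_nonneg_nonneg[of ?a ?b]
    by (simp add: power2_eq_square algebra_simps del: mult_nonneg_nonneg)
  also have "\<dots> = exp (a\<^sup>2 / 4) + exp (b\<^sup>2 / 4)" by (simp flip: exp_add)
  finally show ?thesis .
qed

text \<open>The sums over the common part and over the two differences are independent Gaussians.
  After scaling, the projections are r z + s w and r z + s w' with independent z, w, w', and given z
  the product integrates to a square. Hence the correlation is nonnegative and depends only on the
  overlap.\<close>

lemma integral_proj_proj:
  assumes A: "A \<subseteq> {..<p}" and B: "B \<subseteq> {..<p}" and n: "card A = n" "card B = n" "0 < n"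
    and F_meas[measurable]: "F \<in> borel_measurable borel" and F: "\<And>t. \<bar>F t\<bar> \<le> exp (t\<^sup>2 / 8)"
    and r: "r = sqrt (card (A \<inter> B) / n)" and s: "s = sqrt (1 - card (A \<inter> B) / n)"
  shows "integrable (gaussian_vec p) (\<lambda>x. F (proj A x) * F (proj B x))"
    "(\<integral>x. F (proj A x) * F (proj B x) \<partial>gaussian_vec p) =
     (\<integral>z. std_normal_density z * (\<integral>w. std_normal_density w * F (r * z + s * w) \<partial>lborel)\<^sup>2 \<partial>lborel)"
proof -
  interpret G: prob_space "gaussian_vec p" by (rule prob_space_gaussian_vec)
  interpret N: prob_space std_normal by (rule prob_space_normal_measure) simp
  interpret NN: pair_prob_space std_normal std_normal ..
  interpret NNN: pair_prob_space std_normal "std_normal \<Otimes>\<^sub>M std_normal" ..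
  have ne: "A \<noteq> {}" "B \<noteq> {}" using n by auto
  then have p: "0 < p" using A by auto
  have fin: "finite A" "finite B" using A B finite_subset by auto
  note [measurable] = measurable_proj[OF A] measurable_proj[OF B]
  show int: "integrable (gaussian_vec p) (\<lambda>x. F (proj A x) * F (proj B x))"
  proof (rule Bochner_Integration.integrable_bound)
    show "integrable (gaussian_vec p) (\<lambda>x. exp ((proj A x)\<^sup>2 / 4) + exp ((proj B x)\<^sup>2 / 4))"
      using A B ne by (intro Bochner_Integration.integrable_add integrable_exp_proj_sq)
    show "AE x in gaussian_vec p. norm (F (proj A x) * F (proj B x)) \<le> norm (exp ((proj A x)\<^sup>2 / 4) + exp ((proj B x)\<^sup>2 / 4))"
      using abs_mult_subgaussian_le[OF F F] by (auto intro: order_trans[OF _ abs_ge_self])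
  qed measurable
  let ?S = "\<lambda>C x. \<Sum>i\<in>C. x i :: real"
  let ?D = "(A - B) \<union> (B - A)"
  note ind = indep_gaussian_vec_components[OF p]
  have ind2: "G.indep_var borel (?S (A - B)) borel (?S (B - A))"
  proof -
    have "G.indep_var borel ((\<lambda>y. ?S (A - B) y) \<circ> (\<lambda>x. restrict x (A - B)))
       borel ((\<lambda>y. ?S (B - A) y) \<circ> (\<lambda>x. restrict x (B - A)))"
      using A B by (intro G.indep_var_compose[OF G.indep_var_restrict[OF ind]]) auto
    then show ?thesis by (simp add: comp_def)
  qed
  define i where "i = card (A \<inter> B)"
  have i: "i \<le> n" unfolding i_def n(1)[symmetric] using fin by (intro card_mono) auto
  have cAB: "card (A - B) = n - i" "card (B - A) = n - i"
    using n fin by (auto simp: i_def card_Diff_subset_Int Int_commute)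
  let ?law = "\<lambda>c. distr std_normal borel (\<lambda>z. sqrt (real c) * z)"
  let ?T = "\<lambda>x. (?S (A \<inter> B) x, ?S (A - B) x, ?S (B - A) x)"
  have sub: "A \<inter> B \<subseteq> {..<p}" "A - B \<subseteq> {..<p}" "B - A \<subseteq> {..<p}" using A B by auto
  note [measurable] = sub[THEN measurable_sum_components]
  have "distr (gaussian_vec p) (borel \<Otimes>\<^sub>M borel) (\<lambda>x. (?S (A - B) x, ?S (B - A) x)) = ?law (n - i) \<Otimes>\<^sub>M ?law (n - i)"
    using ind2 sub[THEN distr_gaussian_vec_sum]
    unfolding G.indep_var_distribution_eq cAB by simp
  \<comment> \<open>Independence of the three sums is obtained in two stages: the common block
    against the symmetric difference here, and the two halves of the latter from
    \<open>ind2\<close>.\<close>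
  moreover have "distr (gaussian_vec p) (borel \<Otimes>\<^sub>M (borel \<Otimes>\<^sub>M borel)) ?T = distr (gaussian_vec p) borel (?S (A \<inter> B)) \<Otimes>\<^sub>M
      distr (gaussian_vec p) (borel \<Otimes>\<^sub>M borel) (\<lambda>x. (?S (A - B) x, ?S (B - A) x))"
  proof -
    let ?P = "\<lambda>I. \<Pi>\<^sub>M i\<in>I. (borel :: real measure)"
    let ?X = "\<lambda>I x. \<lambda>i\<in>I. x i :: real"
    have mS[measurable]: "?S C \<in> borel_measurable (?P I)" if "C \<subseteq> I" for C I
      using that by (intro borel_measurable_sum measurable_component_singleton) auto
    have ri: "G.indep_var (?P (A \<inter> B)) (?X (A \<inter> B)) (?P ?D) (?X ?D)"
      using A B by (intro G.indep_var_restrict[OF ind]) auto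
    then have X[measurable]: "?X (A \<inter> B) \<in> gaussian_vec p \<rightarrow>\<^sub>M ?P (A \<inter> B)" "?X ?D \<in> gaussian_vec p \<rightarrow>\<^sub>M ?P ?D"
      by (auto dest: G.indep_var_rv1 G.indep_var_rv2)
    have m[measurable]: "(\<lambda>y. (?S (A - B) y, ?S (B - A) y)) \<in> ?P ?D \<rightarrow>\<^sub>M borel \<Otimes>\<^sub>M borel"
      by (intro measurable_Pair mS) auto
    have "distr (gaussian_vec p) (borel \<Otimes>\<^sub>M (borel \<Otimes>\<^sub>M borel)) ?T =
      distr (distr (gaussian_vec p) (?P (A \<inter> B) \<Otimes>\<^sub>M ?P ?D) (\<lambda>x. (?X (A \<inter> B) x, ?X ?D x)))
        (borel \<Otimes>\<^sub>M (borel \<Otimes>\<^sub>M borel)) (\<lambda>(x, y). (?S (A \<inter> B) x, (?S (A - B) y, ?S (B - A) y)))"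
      by (subst distr_distr) (auto simp: comp_def split_beta')
    also have "\<dots> = distr (distr (gaussian_vec p) (?P (A \<inter> B)) (?X (A \<inter> B)) \<Otimes>\<^sub>M distr (gaussian_vec p) (?P ?D) (?X ?D))
        (borel \<Otimes>\<^sub>M (borel \<Otimes>\<^sub>M borel)) (\<lambda>(x, y). (?S (A \<inter> B) x, (?S (A - B) y, ?S (B - A) y)))"
      using ri unfolding G.indep_var_distribution_eq by simp
    also have "\<dots> = distr (distr (gaussian_vec p) (?P (A \<inter> B)) (?X (A \<inter> B))) borel (?S (A \<inter> B)) \<Otimes>\<^sub>M
        distr (distr (gaussian_vec p) (?P ?D) (?X ?D)) (borel \<Otimes>\<^sub>M borel) (\<lambda>y. (?S (A - B) y, ?S (B - A) y))"
      by (intro pair_measure_distr[symmetric] prob_space_imp_sigma_finite prob_space.prob_space_distr G.prob_space_distr) auto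
    also have "\<dots> = distr (gaussian_vec p) borel (?S (A \<inter> B)) \<Otimes>\<^sub>M
      distr (gaussian_vec p) (borel \<Otimes>\<^sub>M borel) (\<lambda>x. (?S (A - B) x, ?S (B - A) x))"
      by (subst (1 2) distr_distr) (auto simp: comp_def)
    finally show ?thesis .
  qed
  ultimately have "distr (gaussian_vec p) (borel \<Otimes>\<^sub>M (borel \<Otimes>\<^sub>M borel)) ?T = ?law i \<Otimes>\<^sub>M (?law (n - i) \<Otimes>\<^sub>M ?law (n - i))"
    using distr_gaussian_vec_sum[OF sub(1)] by (simp add: i_def)
  also have "\<dots> = distr (std_normal \<Otimes>\<^sub>M (std_normal \<Otimes>\<^sub>M std_normal)) (borel \<Otimes>\<^sub>M (borel \<Otimes>\<^sub>M borel))
      (\<lambda>(z, w, w'). (sqrt i * z, sqrt (n - i) * w, sqrt (n - i) * w'))"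
  proof -
    have 1: "?law (n - i) \<Otimes>\<^sub>M ?law (n - i) = distr (std_normal \<Otimes>\<^sub>M std_normal) (borel \<Otimes>\<^sub>M borel) (\<lambda>(w, w'). (sqrt (n - i) * w, sqrt (n - i) * w'))"
      by (rule pair_measure_distr) (auto intro!: prob_space_imp_sigma_finite N.prob_space_distr)
    show ?thesis unfolding 1
      by (subst pair_measure_distr) (auto intro!: prob_space_imp_sigma_finite NN.prob_space_distr simp: split_beta')
  qed
  finally have law: "distr (gaussian_vec p) (borel \<Otimes>\<^sub>M (borel \<Otimes>\<^sub>M borel)) ?T = \<dots>" .
  let ?H = "\<lambda>(z, w, w'). F ((z + w) / sqrt n) * F ((z + w') / sqrt n)"
  have dec: "proj A x = (?S (A \<inter> B) x + ?S (A - B) x) / sqrt n" "proj B x = (?S (A \<inter> B) x + ?S (B - A) x) / sqrt n" for x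
    using fin sum.Int_Diff[of A x B] sum.Int_Diff[of B x A] by (simp_all add: proj_def n Int_commute)
  have eqH: "F (proj A x) * F (proj B x) = ?H (?T x)" for x
    by (simp add: dec)
  have r': "sqrt i / sqrt n = r" and s': "sqrt (n - i) / sqrt n = s"
    using i n(3) by (simp_all add: r s i_def real_sqrt_divide[symmetric] of_nat_diff diff_divide_distrib)
  have H': "(case (\<lambda>(z, w, w'). (sqrt i * z, sqrt (n - i) * w, sqrt (n - i) * w')) (z, w, w') of (z, w, w') \<Rightarrow> F ((z + w) / sqrt n) * F ((z + w') / sqrt n))
      = F (r * z + s * w) * F (r * z + s * w')" for z w w'
    by (simp add: r'[symmetric] s'[symmetric] add_divide_distrib)
  have int1: "integrable (distr (gaussian_vec p) (borel \<Otimes>\<^sub>M (borel \<Otimes>\<^sub>M borel)) ?T) ?H"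
    using int unfolding eqH by (subst integrable_distr_eq) auto
  have int2: "integrable (std_normal \<Otimes>\<^sub>M (std_normal \<Otimes>\<^sub>M std_normal)) (\<lambda>(z, w, w'). F (r * z + s * w) * F (r * z + s * w'))"
    using int1 unfolding law
    by (subst (asm) integrable_distr_eq) (auto simp: split_beta' H'[unfolded split_beta', simplified])
  have "(\<integral>x. F (proj A x) * F (proj B x) \<partial>gaussian_vec p) = (\<integral>v. ?H v \<partial>distr (gaussian_vec p) (borel \<Otimes>\<^sub>M (borel \<Otimes>\<^sub>M borel)) ?T)"
    unfolding eqH by (subst integral_distr) auto
  also have "\<dots> = (\<integral>v. (case v of (z, w, w') \<Rightarrow> F (r * z + s * w) * F (r * z + s * w')) \<partial>(std_normal \<Otimes>\<^sub>M (std_normal \<Otimes>\<^sub>M std_normal)))"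
    unfolding law by (subst integral_distr) (auto simp: split_beta' H'[unfolded split_beta', simplified])
  also have "\<dots> = (\<integral>z. (\<integral>v. (case v of (w, w') \<Rightarrow> F (r * z + s * w) * F (r * z + s * w')) \<partial>(std_normal \<Otimes>\<^sub>M std_normal)) \<partial>std_normal)"
    using NNN.integral_fst'[OF int2] by simp
  also have "\<dots> = (\<integral>z. (\<integral>w. F (r * z + s * w) \<partial>std_normal)\<^sup>2 \<partial>std_normal)"
  proof (rule integral_cong_AE)
    \<comment> \<open>Fubini guarantees integrability of the inner product only for almost every z,
      so the factorization into a square is an almost-everywhere statement.\<close>
    have "AE z in std_normal. integrable (std_normal \<Otimes>\<^sub>M std_normal) (\<lambda>(w, w'). F (r * z + s * w) * F (r * z + s * w'))"
      using NNN.AE_integrable_fst'[OF int2] by simp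
    then show "AE z in std_normal. (\<integral>v. (case v of (w, w') \<Rightarrow> F (r * z + s * w) * F (r * z + s * w')) \<partial>(std_normal \<Otimes>\<^sub>M std_normal))
        = (\<integral>w. F (r * z + s * w) \<partial>std_normal)\<^sup>2"
    proof eventually_elim
      case (elim z)
      from NN.integral_fst'[OF elim] show ?case by (simp add: power2_eq_square)
    qed
  qed (simp_all add: split_beta')
  also have "\<dots> = (\<integral>z. std_normal_density z * (\<integral>w. std_normal_density w * F (r * z + s * w) \<partial>lborel)\<^sup>2 \<partial>lborel)"
    by (simp add: integral_std_normal)
  finally show "(\<integral>x. F (proj A x) * F (proj B x) \<partial>gaussian_vec p) =
     (\<integral>z. std_normal_density z * (\<integral>w. std_normal_density w * F (r * z + s * w) \<partial>lborel)\<^sup>2 \<partial>lborel)" .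
qed

section \<open>Planted and null models\<close>

lemma (in prob_space) integral_abs_sq_le:
  fixes h :: "'a \<Rightarrow> real"
  assumes [measurable]: "h \<in> borel_measurable M" and h2: "integrable M (\<lambda>x. (h x)\<^sup>2)"
  shows "integrable M h" "(\<integral>x. \<bar>h x\<bar> \<partial>M)\<^sup>2 \<le> (\<integral>x. (h x)\<^sup>2 \<partial>M)"
proof -
  show h: "integrable M h" by (rule square_integrable_imp_integrable[OF _ h2]) measurable
  then have "0 \<le> variance (\<lambda>x. \<bar>h x\<bar>)" by (intro variance_positive)
  also have "variance (\<lambda>x. \<bar>h x\<bar>) = (\<integral>x. (h x)\<^sup>2 \<partial>M) - (\<integral>x. \<bar>h x\<bar> \<partial>M)\<^sup>2"
    using h h2 by (subst variance_eq) auto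
  finally show "(\<integral>x. \<bar>h x\<bar> \<partial>M)\<^sup>2 \<le> (\<integral>x. (h x)\<^sup>2 \<partial>M)" by simp
qed

text \<open>Add up the N detected functions with the signs of their correlations with q. The sum h
  satisfies N \<tau> \<le> E(q h) \<le> E|h|, while E(h^2) \<le> N B + N^2 \<gamma>. As \<gamma> is
  at most \<tau>^2 / 2, the quadratic term is absorbed and N \<le> 2 B / \<tau>^2 remains.\<close>

lemma (in prob_space) card_correlated_le:
  fixes f :: "'v \<Rightarrow> 'a \<Rightarrow> real"
  assumes V: "finite V"
    and meas: "\<And>v. v \<in> V \<Longrightarrow> f v \<in> borel_measurable M"
    and int: "\<And>v w. v \<in> V \<Longrightarrow> w \<in> V \<Longrightarrow> integrable M (\<lambda>x. f v x * f w x)"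
    and diag: "\<And>v. v \<in> V \<Longrightarrow> (\<integral>x. f v x * f v x \<partial>M) \<le> B"
    and offdiag: "\<And>v w. v \<in> V \<Longrightarrow> w \<in> V \<Longrightarrow> v \<noteq> w \<Longrightarrow> \<bar>\<integral>x. f v x * f w x \<partial>M\<bar> \<le> \<gamma>"
    and q_meas: "q \<in> borel_measurable M" and q: "\<And>x. x \<in> space M \<Longrightarrow> \<bar>q x\<bar> \<le> 1"
    and \<tau>: "0 < \<tau>" "2 * \<gamma> \<le> \<tau>\<^sup>2" and pos: "0 \<le> B" "0 \<le> \<gamma>"
  shows "real (card {v \<in> V. \<tau> < \<bar>\<integral>x. q x * f v x \<partial>M\<bar>}) \<le> 2 * B / \<tau>\<^sup>2"
proof -
  note [measurable] = q_meas
  define W where "W = {v \<in> V. \<tau> < \<bar>\<integral>x. q x * f v x \<partial>M\<bar>}"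
  define N where "N = real (card W)"
  have W: "W \<subseteq> V" "finite W" using V by (auto simp: W_def)
  have mW[measurable]: "f v \<in> borel_measurable M" if "v \<in> W" for v using meas that W by auto
  define sg where "sg v = sgn (\<integral>x. q x * f v x \<partial>M)" for v
  have sg: "\<bar>sg v * sg w\<bar> \<le> 1" for v w by (auto simp: sg_def abs_mult abs_sgn_eq)
  define h where "h x = (\<Sum>v\<in>W. sg v * f v x)" for x
  have [measurable]: "h \<in> borel_measurable M" unfolding h_def by measurable
  have h2_eq: "(h x)\<^sup>2 = (\<Sum>v\<in>W. \<Sum>w\<in>W. (sg v * sg w) * (f v x * f w x))" for x
    by (simp add: h_def power2_eq_square sum_product mult_ac)
  have intW: "integrable M (\<lambda>x. f v x * f w x)" if "v \<in> W" "w \<in> W" for v w using int that W by auto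
  have h2: "integrable M (\<lambda>x. (h x)\<^sup>2)"
    unfolding h2_eq using intW by (intro Bochner_Integration.integrable_sum integrable_mult_right) auto
  have "(\<integral>x. (h x)\<^sup>2 \<partial>M) = (\<Sum>v\<in>W. \<Sum>w\<in>W. (sg v * sg w) * (\<integral>x. f v x * f w x \<partial>M))"
  proof -
    have "(\<integral>x. (h x)\<^sup>2 \<partial>M) = (\<Sum>v\<in>W. \<integral>x. (\<Sum>w\<in>W. (sg v * sg w) * (f v x * f w x)) \<partial>M)"
      unfolding h2_eq
      by (intro Bochner_Integration.integral_sum Bochner_Integration.integrable_sum integrable_mult_right intW)
    also have "\<dots> = (\<Sum>v\<in>W. \<Sum>w\<in>W. \<integral>x. (sg v * sg w) * (f v x * f w x) \<partial>M)"
      by (intro sum.cong refl Bochner_Integration.integral_sum integrable_mult_right intW)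
    finally show ?thesis by simp
  qed
  also have "\<dots> \<le> (\<Sum>v\<in>W. \<Sum>w\<in>W. (if v = w then B else 0) + \<gamma>)"
  proof (intro sum_mono)
    fix v w assume vw: "v \<in> W" "w \<in> W"
    have "(sg v * sg w) * (\<integral>x. f v x * f w x \<partial>M) \<le> \<bar>\<integral>x. f v x * f w x \<partial>M\<bar>"
      using mult_right_mono[OF sg[of v w], of "\<bar>\<integral>x. f v x * f w x \<partial>M\<bar>"]
      by (simp add: abs_mult[symmetric] abs_le_iff)
    also have "\<dots> \<le> (if v = w then B else 0) + \<gamma>"
      using offdiag[of v w] diag[of v] vw W(1) pos by (auto simp: subset_iff add_increasing2)
    finally show "(sg v * sg w) * (\<integral>x. f v x * f w x \<partial>M) \<le> (if v = w then B else 0) + \<gamma>" .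
  qed
  also have "\<dots> = N * B + N\<^sup>2 * \<gamma>"
    using W(2) by (simp add: sum.distrib N_def power2_eq_square distrib_left mult.assoc)
  finally have ub: "(\<integral>x. (h x)\<^sup>2 \<partial>M) \<le> N * B + N\<^sup>2 * \<gamma>" .
  have f_int: "integrable M (f v)" if "v \<in> W" for v
    using intW[OF that that]
    by (rule integral_abs_sq_le(1)[OF mW[OF that], unfolded power2_eq_square])
  have qf_int: "integrable M (\<lambda>x. q x * f v x)" if "v \<in> W" for v
    using q f_int[OF that] that
    by (intro Bochner_Integration.integrable_bound[OF f_int[OF that]]) (auto simp: abs_mult intro!: AE_I2 mult_left_le_one_le)
  have h_int: "integrable M h" by (rule integral_abs_sq_le(1)[OF _ h2]) measurable
  have qh_int: "integrable M (\<lambda>x. q x * h x)"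
    using q h_int
    by (intro Bochner_Integration.integrable_bound[OF h_int]) (auto simp: abs_mult intro!: AE_I2 mult_left_le_one_le)
  have "N * \<tau> \<le> (\<Sum>v\<in>W. sg v * (\<integral>x. q x * f v x \<partial>M))"
    unfolding N_def by (subst sum_constant[symmetric], rule sum_mono) (auto simp: W_def sg_def sgn_mult_self_eq abs_sgn mult.commute)
  also have "\<dots> = (\<integral>x. q x * h x \<partial>M)"
  proof -
    have "q x * h x = (\<Sum>v\<in>W. sg v * (q x * f v x))" for x
      by (simp add: h_def sum_distrib_left mult.left_commute)
    then have "(\<integral>x. q x * h x \<partial>M) = (\<Sum>v\<in>W. \<integral>x. sg v * (q x * f v x) \<partial>M)"
      using qf_int by (simp only: Bochner_Integration.integral_sum integrable_mult_right)
    then show ?thesis by simp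
  qed
  also have "\<dots> \<le> (\<integral>x. \<bar>h x\<bar> \<partial>M)"
  proof (rule integral_mono[OF qh_int])
    fix x assume "x \<in> space M"
    then have "\<bar>q x * h x\<bar> \<le> \<bar>h x\<bar>" unfolding abs_mult using q by (intro mult_left_le_one_le) auto
    then show "q x * h x \<le> \<bar>h x\<bar>" by linarith
  qed (use h_int in auto)
  finally have "(N * \<tau>)\<^sup>2 \<le> (\<integral>x. \<bar>h x\<bar> \<partial>M)\<^sup>2"
    using \<tau> by (intro power_mono) (auto simp: N_def)
  also have "\<dots> \<le> N * B + N\<^sup>2 * \<gamma>" using integral_abs_sq_le(2)[OF _ h2] ub by simp
  also have "N\<^sup>2 * \<gamma> \<le> N\<^sup>2 * (\<tau>\<^sup>2 / 2)" using \<tau> by (intro mult_left_mono) auto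
  finally have "N * (N * \<tau>\<^sup>2) \<le> N * (2 * B)" by (simp add: power_mult_distrib power2_eq_square field_simps)
  then have "N * \<tau>\<^sup>2 \<le> 2 * B"
    using pos by (cases "N = 0") (auto simp: N_def mult_le_cancel_left)
  then show ?thesis using \<tau> by (simp add: N_def W_def pos_le_divide_eq)
qed

context hidden_shift begin

section \<open>The planted laws belong to the contamination class\<close>

definition resp_law :: "real measure" where
  "resp_law = density lborel (\<lambda>y. ennreal (resp y))"

lemma sets_resp_law[simp, measurable_cong]: "sets resp_law = sets borel"
  by (simp add: resp_law_def)

lemma space_resp_law[simp]: "space resp_law = UNIV"
  by (simp add: resp_law_def)

lemma prob_space_resp_law: "prob_space resp_law"
proof
  have "emeasure resp_law (space resp_law) = (\<integral>\<^sup>+ y. ennreal (resp y) \<partial>lborel)"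
    by (simp add: resp_law_def emeasure_density)
  also have "\<dots> = ennreal (\<integral>y. resp y \<partial>lborel)"
    using resp_integral(1) resp_pos by (intro nn_integral_eq_integral) (auto simp: less_imp_le)
  finally show "emeasure resp_law (space resp_law) = 1" by (simp add: resp_integral)
qed

definition null_model :: "nat \<Rightarrow> (rvec \<times> real) measure" where
  "null_model p = gaussian_vec p \<Otimes>\<^sub>M resp_law"

definition planted_model :: "nat \<Rightarrow> nat set \<Rightarrow> (rvec \<times> real) measure" where
  "planted_model p A = density (null_model p) (\<lambda>(x, y). ennreal (1 + score (proj A x) y))"

lemma sets_null_model[measurable_cong]: "sets (null_model p) = sets (sample_space p)"
  unfolding null_model_def sample_space_def by (intro sets_pair_measure_cong sets_gaussian_vec) simp

lemma space_null_model: "space (null_model p) = space (sample_space p)"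
  by (rule sets_eq_imp_space_eq) (rule sets_null_model)

lemma prob_space_null_model: "prob_space (null_model p)"
proof -
  interpret G: prob_space "gaussian_vec p" by (rule prob_space_gaussian_vec)
  interpret R: prob_space resp_law by (rule prob_space_resp_law)
  interpret pair_prob_space "gaussian_vec p" resp_law ..
  show ?thesis unfolding null_model_def by unfold_locales
qed

lemma one_plus_score_nonneg: "0 \<le> 1 + score t y"
proof -
  have "0 \<le> resp y * (1 + score t y)"
    unfolding mixture_eq[symmetric] using eps contam_nonneg[of t y] by (intro add_nonneg_nonneg) auto
  then show ?thesis using resp_pos[of y] by (simp add: zero_le_mult_iff)
qed

lemma measurable_score_proj:
  assumes "A \<subseteq> {..<p}"
  shows "(\<lambda>z. score (proj A (fst z)) (snd z)) \<in> borel_measurable (null_model p)"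
proof -
  have [measurable]: "proj A \<in> borel_measurable (gaussian_vec p)"
    using measurable_proj[OF assms] by (simp cong: measurable_cong_sets[OF sets_gaussian_vec])
  show ?thesis unfolding null_model_def by measurable
qed

definition planted_vec :: "nat \<Rightarrow> nat set \<Rightarrow> rvec" where
  "planted_vec p A = (\<lambda>i\<in>{..<p}. if i \<in> A then \<kappa> / sqrt (card A) else 0)"

lemma dot_planted_vec: "A \<subseteq> {..<p} \<Longrightarrow> dot p x (planted_vec p A) = \<kappa> * proj A x"
proof -
  assume A: "A \<subseteq> {..<p}"
  have "dot p x (planted_vec p A) = (\<Sum>i<p. if i \<in> A then x i * (\<kappa> / sqrt (card A)) else 0)"
    by (auto simp: dot_def planted_vec_def intro!: sum.cong)
  also have "\<dots> = (\<Sum>i\<in>A. x i * (\<kappa> / sqrt (card A)))"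
    using A by (simp add: sum.If_cases Int_absorb1 Int_def[symmetric])
  finally show ?thesis by (simp add: proj_def sum_distrib_right sum_divide_distrib mult_ac sum_distrib_left)
qed

text \<open>The kernel Q uses x only through its projection, and \<open>dot_planted_vec\<close> says
  that the regression mean does so too. Thus \<open>mixture_eq\<close> identifies the conditional
  densities at every x.\<close>

lemma planted_model_contaminated:
  assumes A: "A \<subseteq> {..<p}"
  shows "planted_model p A \<in> contaminated_model p (planted_vec p A) 1 eps"
proof -
  interpret R: prob_space resp_law by (rule prob_space_resp_law)
  have [measurable]: "proj A \<in> borel_measurable (vec_borel p)" by (rule measurable_proj[OF A])
  define Q where "Q x = density lborel (\<lambda>y. ennreal (contam (proj A x) y))" for x
  have pQ: "prob_space (Q x)" for x
  proof
    have "emeasure (Q x) (space (Q x)) = (\<integral>\<^sup>+ y. ennreal (contam (proj A x) y) \<partial>lborel)"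
      by (simp add: Q_def emeasure_density)
    also have "\<dots> = ennreal (\<integral>y. contam (proj A x) y \<partial>lborel)"
      using contam_integral(1) contam_nonneg by (intro nn_integral_eq_integral) auto
    finally show "emeasure (Q x) (space (Q x)) = 1" by (simp add: contam_integral)
  qed
  have Q: "Q \<in> vec_borel p \<rightarrow>\<^sub>M prob_algebra borel"
  proof (rule measurable_prob_algebraI)
    show "prob_space (Q x)" for x by (rule pQ)
    show "Q \<in> vec_borel p \<rightarrow>\<^sub>M subprob_algebra borel"
    proof (rule measurable_subprob_algebra)
      show "subprob_space (Q x)" for x using pQ by (rule prob_space_imp_subprob_space)
      show "sets (Q x) = sets borel" for x by (simp add: Q_def)
      fix S :: "real set" assume [measurable]: "S \<in> sets borel"
      have "emeasure (Q x) S = (\<integral>\<^sup>+ y. ennreal (contam (proj A x) y) * indicator S y \<partial>lborel)" for x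
        by (simp add: Q_def emeasure_density)
      then show "(\<lambda>x. emeasure (Q x) S) \<in> borel_measurable (vec_borel p)"
        by simp
    qed
  qed
  have "emeasure (planted_model p A) S =
      (\<integral>\<^sup>+ x. (ennreal (1 - eps) * emeasure (normal_measure (dot p x (planted_vec p A)) 1) {y. (x, y) \<in> S}
         + ennreal eps * emeasure (Q x) {y. (x, y) \<in> S}) \<partial>gaussian_vec p)"
    if S[measurable]: "S \<in> sets (sample_space p)" for S
  proof -
    have S': "S \<in> sets (null_model p)" using S sets_null_model by simp
    have m: "(\<lambda>z. ennreal (1 + score (proj A (fst z)) (snd z)) * indicator S z) \<in> borel_measurable (gaussian_vec p \<Otimes>\<^sub>M resp_law)"
      using measurable_score_proj[OF A] S' unfolding null_model_def by measurable
    have "emeasure (planted_model p A) S = (\<integral>\<^sup>+ z. ennreal (1 + score (proj A (fst z)) (snd z)) * indicator S z \<partial>null_model p)"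
      unfolding planted_model_def using measurable_score_proj[OF A] S'
      by (subst emeasure_density) (auto simp: split_beta')
    also have "\<dots> = (\<integral>\<^sup>+ x. \<integral>\<^sup>+ y. ennreal (1 + score (proj A x) y) * indicator S (x, y) \<partial>resp_law \<partial>gaussian_vec p)"
      unfolding null_model_def R.nn_integral_fst[OF m, symmetric] by simp
    also have "\<dots> = (\<integral>\<^sup>+ x. (ennreal (1 - eps) * emeasure (normal_measure (dot p x (planted_vec p A)) 1) {y. (x, y) \<in> S}
         + ennreal eps * emeasure (Q x) {y. (x, y) \<in> S}) \<partial>gaussian_vec p)"
    proof (rule nn_integral_cong)
      fix x assume "x \<in> space (gaussian_vec p)"
      let ?S = "{y. (x, y) \<in> S}"
      have [measurable]: "?S \<in> sets borel"
        using sets_Pair1[of S "vec_borel p" borel x] S by (simp add: sample_space_def vimage_def)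
      have "(\<integral>\<^sup>+ y. ennreal (1 + score (proj A x) y) * indicator S (x, y) \<partial>resp_law)
          = (\<integral>\<^sup>+ y. ennreal (1 + score (proj A x) y) * indicator ?S y \<partial>resp_law)"
        by (intro nn_integral_cong) (simp add: indicator_def)
      also have "\<dots> = (\<integral>\<^sup>+ y. ennreal (resp y) * (ennreal (1 + score (proj A x) y) * indicator ?S y) \<partial>lborel)"
        unfolding resp_law_def by (subst nn_integral_density) measurable
      also have "\<dots> = (\<integral>\<^sup>+ y. ennreal (1 - eps) * (ennreal (normal_density (\<kappa> * proj A x) 1 y) * indicator ?S y)
          + ennreal eps * (ennreal (contam (proj A x) y) * indicator ?S y) \<partial>lborel)"
      proof (rule nn_integral_cong)
        fix y
        have "ennreal (resp y) * ennreal (1 + score (proj A x) y) = ennreal (1 - eps) * ennreal (normal_density (\<kappa> * proj A x) 1 y) + ennreal eps * ennreal (contam (proj A x) y)"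
          using eps resp_pos[of y] one_plus_score_nonneg[of "proj A x" y] contam_nonneg[of "proj A x" y]
          by (simp add: mixture_eq flip: ennreal_mult ennreal_plus)
        then show "ennreal (resp y) * (ennreal (1 + score (proj A x) y) * indicator ?S y) = ennreal (1 - eps) * (ennreal (normal_density (\<kappa> * proj A x) 1 y) * indicator ?S y)
          + ennreal eps * (ennreal (contam (proj A x) y) * indicator ?S y)"
          by (simp add: mult.assoc[symmetric] distrib_right[symmetric])
      qed
      also have "\<dots> = ennreal (1 - eps) * emeasure (normal_measure (\<kappa> * proj A x) 1) ?S + ennreal eps * emeasure (Q x) ?S"
        unfolding normal_measure_def Q_def
        by (subst nn_integral_add) (simp_all add: nn_integral_cmult emeasure_density)
      finally show "(\<integral>\<^sup>+ y. ennreal (1 + score (proj A x) y) * indicator S (x, y) \<partial>resp_law)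
        = ennreal (1 - eps) * emeasure (normal_measure (dot p x (planted_vec p A)) 1) ?S + ennreal eps * emeasure (Q x) ?S"
        unfolding dot_planted_vec[OF A] .
    qed
    finally show ?thesis .
  qed
  then show ?thesis
    unfolding contaminated_model_def using Q
    by (auto simp: planted_model_def sets_null_model intro!: bexI[of _ Q])
qed

section \<open>Pairwise correlations under the null model\<close>

text \<open>Under the null model y is independent of x, so the correlation is an average over y of
  Gaussian correlations in which y is a frozen parameter of \<open>score\<close>.\<close>

lemma score_proj_correlation:
  assumes A: "A \<subseteq> {..<p}" "card A = n" and B: "B \<subseteq> {..<p}" "card B = n" and n: "0 < n"
  shows "integrable (null_model p) (\<lambda>z. score (proj A (fst z)) (snd z) * score (proj B (fst z)) (snd z))"
    "(\<integral>z. score (proj A (fst z)) (snd z) * score (proj B (fst z)) (snd z) \<partial>null_model p)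
      = (\<integral>y. (\<integral>x. score (proj A x) y * score (proj B x) y \<partial>gaussian_vec p) \<partial>resp_law)"
proof -
  interpret G: prob_space "gaussian_vec p" by (rule prob_space_gaussian_vec)
  interpret R: prob_space resp_law by (rule prob_space_resp_law)
  interpret GR: pair_prob_space "gaussian_vec p" resp_law ..
  have ne: "A \<noteq> {}" "B \<noteq> {}" using A B n by auto
  note [measurable] = measurable_proj[OF A(1)] measurable_proj[OF B(1)]
    measurable_score_proj[OF A(1)] measurable_score_proj[OF B(1)]
  let ?g = "\<lambda>x. exp ((proj A x)\<^sup>2 / 4) + exp ((proj B x)\<^sup>2 / 4)"
  have g: "integrable (gaussian_vec p) ?g"
    using A B ne by (intro Bochner_Integration.integrable_add integrable_exp_proj_sq)
  have "integrable (null_model p) (\<lambda>z. ?g (fst z))"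
    unfolding null_model_def using g by (intro GR.Fubini_integrable) auto
  then show int: "integrable (null_model p) (\<lambda>z. score (proj A (fst z)) (snd z) * score (proj B (fst z)) (snd z))"
    by (rule Bochner_Integration.integrable_bound)
      (use abs_mult_subgaussian_le[OF abs_score_le abs_score_le] in \<open>auto intro: order_trans[OF _ abs_ge_self]\<close>)
  then show "(\<integral>z. score (proj A (fst z)) (snd z) * score (proj B (fst z)) (snd z) \<partial>null_model p)
      = (\<integral>y. (\<integral>x. score (proj A x) y * score (proj B x) y \<partial>gaussian_vec p) \<partial>resp_law)"
    unfolding null_model_def
    by (subst GR.integral_snd) (auto simp: split_beta')
qed

lemma resp_law_integral_bounds:
  fixes f :: "real \<Rightarrow> real"
  assumes [measurable]: "f \<in> borel_measurable borel" and f: "\<And>y. 0 \<le> f y" "\<And>y. f y \<le> c"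
  shows "0 \<le> (\<integral>y. f y \<partial>resp_law)" "(\<integral>y. f y \<partial>resp_law) \<le> c"
proof -
  interpret R: prob_space resp_law by (rule prob_space_resp_law)
  show "0 \<le> (\<integral>y. f y \<partial>resp_law)" by (rule Bochner_Integration.integral_nonneg) (rule f)
  have "integrable resp_law f"
    using f by (intro R.integrable_const_bound[where B = c]) (auto intro!: AE_I2 simp: abs_of_nonneg)
  then show "(\<integral>y. f y \<partial>resp_law) \<le> c" using f by (intro R.integral_le_const) auto
qed

lemma score_proj_norm_le:
  assumes A: "A \<subseteq> {..<p}" "card A = n" and n: "0 < n"
  shows "(\<integral>z. score (proj A (fst z)) (snd z) * score (proj A (fst z)) (snd z) \<partial>null_model p) \<le> 2"
proof -
  interpret G: prob_space "gaussian_vec p" by (rule prob_space_gaussian_vec)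
  note [measurable] = measurable_proj[OF A(1)]
  have ne: "A \<noteq> {}" using A n by auto
  have "(\<integral>x. score (proj A x) y * score (proj A x) y \<partial>gaussian_vec p) \<le> 2" for y
  proof -
    have "(\<integral>x. score (proj A x) y * score (proj A x) y \<partial>gaussian_vec p) \<le> (\<integral>x. exp ((proj A x)\<^sup>2 / 4) \<partial>gaussian_vec p)"
    proof (rule integral_mono)
      show "integrable (gaussian_vec p) (\<lambda>x. score (proj A x) y * score (proj A x) y)"
        using A n abs_score_le by (intro integral_proj_proj(1)[where F = "\<lambda>t. score t y"]) auto
      show "integrable (gaussian_vec p) (\<lambda>x. exp ((proj A x)\<^sup>2 / 4))"
        using A ne by (intro integrable_exp_proj_sq)
      fix x
      have "\<bar>score (proj A x) y\<bar> * \<bar>score (proj A x) y\<bar> \<le> exp ((proj A x)\<^sup>2 / 8) * exp ((proj A x)\<^sup>2 / 8)"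
        by (intro mult_mono abs_score_le) auto
      then show "score (proj A x) y * score (proj A x) y \<le> exp ((proj A x)\<^sup>2 / 4)"
        by (simp flip: exp_add)
    qed
    also have "\<dots> = sqrt 2" using A ne by (intro integrable_exp_proj_sq)
    also have "\<dots> \<le> 2" by (intro real_le_lsqrt) auto
    finally show ?thesis .
  qed
  then show ?thesis
    unfolding score_proj_correlation(2)[OF A A n]
    by (intro resp_law_integral_bounds(2)) auto
qed

text \<open>The moments of \<open>score\<close> vanish for each y separately, so
  \<open>integral_smoothed_sq_le\<close> applies at every y with r^2 equal to the overlap fraction,
  and averaging preserves the bound. The condition on the overlap is r \<le> 1 / 16.\<close>

lemma score_proj_correlation_le:
  assumes A: "A \<subseteq> {..<p}" "card A = n" and B: "B \<subseteq> {..<p}" "card B = n" and n: "0 < n"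
    and m: "m = 2 * M" and small: "256 * card (A \<inter> B) \<le> n"
  shows "\<bar>\<integral>z. score (proj A (fst z)) (snd z) * score (proj B (fst z)) (snd z) \<partial>null_model p\<bar>
    \<le> 12 * (256 * (card (A \<inter> B) / n)) ^ Suc M"
proof -
  interpret G: prob_space "gaussian_vec p" by (rule prob_space_gaussian_vec)
  note [measurable] = measurable_proj[OF A(1)] measurable_proj[OF B(1)]
  define i where "i = card (A \<inter> B)"
  define r where "r = sqrt (i / n)"
  define s where "s = sqrt (1 - i / n)"
  have i: "real i / n \<le> 1 / 256"
  proof -
    have "real (256 * i) \<le> real n" using small unfolding i_def by (rule of_nat_mono)
    then show ?thesis using n by (simp add: field_simps)
  qed
  have r: "0 \<le> r" "r \<le> 1 / 16"
  proof -
    show "0 \<le> r" by (simp add: r_def)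
    have "r \<le> sqrt (1 / 256)" unfolding r_def using i by (rule real_sqrt_le_mono)
    also have "sqrt (1 / 256) = sqrt ((1 / 16)\<^sup>2)" by (simp add: power_divide)
    finally show "r \<le> 1 / 16" by (simp only: real_sqrt_abs)
  qed
  have "0 < 1 - i / n" using i by linarith
  then have s: "0 < s" "r\<^sup>2 + s\<^sup>2 = 1" by (auto simp: r_def s_def)
  have r2: "r\<^sup>2 = i / n" by (simp add: r_def)
  let ?c = "\<lambda>y. \<integral>x. score (proj A x) y * score (proj B x) y \<partial>gaussian_vec p"
  have eq: "?c y = (\<integral>z. std_normal_density z * (\<integral>w. std_normal_density w * score (r * z + s * w) y \<partial>lborel)\<^sup>2 \<partial>lborel)" for y
    using A B n abs_score_le
    by (intro integral_proj_proj(2)[where F = "\<lambda>t. score t y" and n = n]) (auto simp: r_def s_def i_def)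
  have lo: "0 \<le> ?c y" for y
    unfolding eq by (intro Bochner_Integration.integral_nonneg) auto
  have hi: "?c y \<le> 12 * (256 * r\<^sup>2) ^ Suc M" for y
    unfolding eq
  proof (rule integral_smoothed_sq_le[OF _ abs_score_le _ r s])
    show "(\<integral>t. std_normal_density t * score t y * t ^ j \<partial>lborel) = 0" if "j \<le> 2 * M" for j
      using that m by (intro score_moment) simp
  qed measurable
  show ?thesis
    using resp_law_integral_bounds[OF _ lo hi]
    unfolding score_proj_correlation(2)[OF A B n] r2 i_def by simp
qed

lemma integral_planted_model:
  assumes A: "A \<subseteq> {..<p}" "card A = n" "0 < n" and q: "q \<in> queries p"
  shows "(\<integral>z. q z \<partial>planted_model p A)
    = (\<integral>z. q z \<partial>null_model p) + (\<integral>z. q z * score (proj A (fst z)) (snd z) \<partial>null_model p)"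
proof -
  interpret N: prob_space "null_model p" by (rule prob_space_null_model)
  note [measurable] = measurable_score_proj[OF A(1)]
  have [measurable]: "q \<in> borel_measurable (null_model p)"
    using q by (simp add: queries_def measurable_cong_sets[OF sets_null_model refl])
  have q1: "\<bar>q z\<bar> \<le> 1" if "z \<in> space (null_model p)" for z
    using q that by (auto simp: queries_def space_null_model abs_le_iff PiE_iff)
  have iq: "integrable (null_model p) q"
    using q1 by (intro N.integrable_const_bound[where B = 1]) (auto intro!: AE_I2)
  have isc: "integrable (null_model p) (\<lambda>z. score (proj A (fst z)) (snd z))"
    by (rule N.integral_abs_sq_le(1)[unfolded power2_eq_square,
          OF measurable_score_proj[OF A(1)] score_proj_correlation(1)[OF A(1,2) A(1,2) A(3)]])
  have iqs: "integrable (null_model p) (\<lambda>z. q z * score (proj A (fst z)) (snd z))"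
    using q1 by (intro Bochner_Integration.integrable_bound[OF isc])
      (auto simp: abs_mult intro!: AE_I2 mult_left_le_one_le)
  have "(\<integral>z. q z \<partial>planted_model p A) = (\<integral>z. (1 + score (proj A (fst z)) (snd z)) * q z \<partial>null_model p)"
    unfolding planted_model_def split_beta'
    using one_plus_score_nonneg by (subst integral_density) auto
  also have "\<dots> = (\<integral>z. q z + q z * score (proj A (fst z)) (snd z) \<partial>null_model p)"
    by (simp add: algebra_simps)
  finally show ?thesis using iq iqs by simp
qed

lemma planted_vec_in_space: "planted_vec p A \<in> space (vec_borel p)"
  by (simp add: planted_vec_def vec_borel_def space_PiM)

lemma norm2_planted_vec_le:
  assumes A: "A \<subseteq> {..<p}" "card A = n" and n: "0 < n"
  shows "norm2 p (planted_vec p A) \<le> 1"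
proof -
  have "(\<Sum>i<p. (planted_vec p A i)\<^sup>2) = (\<Sum>i<p. if i \<in> A then \<kappa>\<^sup>2 / n else 0)"
    using A by (intro sum.cong) (auto simp: planted_vec_def power_divide)
  also have "\<dots> = (\<Sum>i\<in>A. \<kappa>\<^sup>2 / n)"
    using A by (simp add: sum.If_cases Int_absorb1 Int_def[symmetric])
  also have "\<dots> = \<kappa>\<^sup>2" using A n by simp
  finally have "norm2 p (planted_vec p A) = \<kappa>"
    using \<kappa>_pos by (simp add: norm2_def L2_set_def)
  then show ?thesis using \<kappa>_le by simp
qed

text \<open>A small overlap leaves a symmetric difference of at least n indices, on each of which
  the squared difference is \<kappa>^2 / n.\<close>

lemma norm2_planted_vec_diff_ge:
  assumes A: "A \<subseteq> {..<p}" "card A = n" and B: "B \<subseteq> {..<p}" "card B = n" and n: "0 < n"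
    and small: "256 * card (A \<inter> B) \<le> n"
  shows "\<kappa> \<le> norm2 p (\<lambda>i. planted_vec p A i - planted_vec p B i)"
proof -
  have fin: "finite A" "finite B" using A B finite_subset by auto
  let ?D = "(A - B) \<union> (B - A)"
  have "card ?D = card (A - B) + card (B - A)"
    using fin by (intro card_Un_disjoint) auto
  then have c: "n \<le> card ?D"
    using small A(2) B(2) fin by (simp add: card_Diff_subset_Int Int_commute)
  have "\<kappa>\<^sup>2 = n * (\<kappa>\<^sup>2 / n)" using n by simp
  also have "\<dots> \<le> card ?D * (\<kappa>\<^sup>2 / n)" using c by (intro mult_right_mono) auto
  also have "\<dots> = (\<Sum>i\<in>?D. \<kappa>\<^sup>2 / n)" by (simp only: sum_constant of_nat_mult)
  also have "\<dots> = (\<Sum>i\<in>?D. (planted_vec p A i - planted_vec p B i)\<^sup>2)"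
    using A B by (intro sum.cong) (auto simp: planted_vec_def power_divide)
  also have "\<dots> \<le> (\<Sum>i<p. (planted_vec p A i - planted_vec p B i)\<^sup>2)"
    using A B by (intro sum_mono2) auto
  finally have "sqrt (\<kappa>\<^sup>2) \<le> norm2 p (\<lambda>i. planted_vec p A i - planted_vec p B i)"
    unfolding norm2_def L2_set_def by (rule real_sqrt_le_mono)
  then show ?thesis using \<kappa>_pos by simp
qed

text \<open>Null expectations serve as the default answers. The second-moment bound B = 2 yields 4 /
  \<tau>^2 exposed sets per query, and 24 is twice the constant 12 of the correlation bound, as the
  condition 2 \<gamma> \<le> \<tau>^2 demands.\<close>

lemma regression_query_lower_bound:
  assumes sol: "solves_regression p eps \<delta> k \<tau> S" and \<delta>: "2 * \<delta> < \<kappa>" and \<tau>: "0 < \<tau>"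
    and m: "m = 2 * M" and n: "0 < n" and t: "256 * t \<le> n"
    and \<A>: "\<A> \<subseteq> {A. A \<subseteq> {..<p} \<and> card A = n}"
    and disj: "\<And>A B. A \<in> \<A> \<Longrightarrow> B \<in> \<A> \<Longrightarrow> A \<noteq> B \<Longrightarrow> card (A \<inter> B) < t"
    and \<tau>_ge: "24 * (256 * (t / n)) ^ Suc M \<le> \<tau>\<^sup>2"
  shows "0.9 * real (card \<A>) \<le> 1 + real k * (4 / \<tau>\<^sup>2)"
proof (rule solvers_need_many_queries[OF sol, where b = "planted_vec p" and P = "planted_model p" and E = "\<lambda>q. \<integral>z. q z \<partial>null_model p"])
  interpret N: prob_space "null_model p" by (rule prob_space_null_model)
  have A: "A \<subseteq> {..<p}" "card A = n" if "A \<in> \<A>" for A using \<A> that by auto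
  have small: "256 * card (A \<inter> B) \<le> n" if "A \<in> \<A>" "B \<in> \<A>" "A \<noteq> B" for A B
    using disj[OF that] t by simp
  show fin: "finite \<A>" using \<A> by (rule finite_subset) simp
  show "0 \<le> \<tau>" using \<tau> by simp
  show "planted_vec p A \<in> space (vec_borel p)" for A by (rule planted_vec_in_space)
  show "norm2 p (planted_vec p A) \<le> 1" if "A \<in> \<A>" for A
    by (rule norm2_planted_vec_le[OF A[OF that] n])
  show "2 * \<delta> < norm2 p (\<lambda>i. planted_vec p A i - planted_vec p B i)"
    if "A \<in> \<A>" "B \<in> \<A>" "A \<noteq> B" for A B
    using norm2_planted_vec_diff_ge[OF A[OF that(1)] A[OF that(2)] n small[OF that]] \<delta> by simp
  show "planted_model p A \<in> contaminated_model p (planted_vec p A) 1 eps" if "A \<in> \<A>" for A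
    by (rule planted_model_contaminated[OF A(1)[OF that]])
  fix q assume q: "q \<in> queries p"
  let ?f = "\<lambda>A z. score (proj A (fst z)) (snd z)"
  have "{A \<in> \<A>. \<tau> < \<bar>(\<integral>z. q z \<partial>null_model p) - (\<integral>z. q z \<partial>planted_model p A)\<bar>}
      = {A \<in> \<A>. \<tau> < \<bar>\<integral>z. q z * ?f A z \<partial>null_model p\<bar>}"
    using integral_planted_model[OF A n q] by auto
  moreover have "real (card {A \<in> \<A>. \<tau> < \<bar>\<integral>z. q z * ?f A z \<partial>null_model p\<bar>}) \<le> 2 * 2 / \<tau>\<^sup>2"
  proof (rule N.card_correlated_le[OF fin, where \<gamma> = "12 * (256 * (t / n)) ^ Suc M"])
    show "?f A \<in> borel_measurable (null_model p)" if "A \<in> \<A>" for A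
      by (rule measurable_score_proj[OF A(1)[OF that]])
    show "integrable (null_model p) (\<lambda>z. ?f A z * ?f B z)" if "A \<in> \<A>" "B \<in> \<A>" for A B
      by (rule score_proj_correlation(1)[OF A[OF that(1)] A[OF that(2)] n])
    show "(\<integral>z. ?f A z * ?f A z \<partial>null_model p) \<le> 2" if "A \<in> \<A>" for A
      by (rule score_proj_norm_le[OF A[OF that] n])
    show "\<bar>\<integral>z. ?f A z * ?f B z \<partial>null_model p\<bar> \<le> 12 * (256 * (t / n)) ^ Suc M"
      if "A \<in> \<A>" "B \<in> \<A>" "A \<noteq> B" for A B
    proof (rule order_trans[OF score_proj_correlation_le[OF A[OF that(1)] A[OF that(2)] n m small[OF that]]])
      show "12 * (256 * (card (A \<inter> B) / n)) ^ Suc M \<le> 12 * (256 * (t / n)) ^ Suc M"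
        using disj[OF that] by (intro mult_left_mono power_mono divide_right_mono) auto
    qed
    show "q \<in> borel_measurable (null_model p)"
      using q by (simp add: queries_def measurable_cong_sets[OF sets_null_model refl])
    show "\<bar>q z\<bar> \<le> 1" if "z \<in> space (null_model p)" for z
      using q that by (auto simp: queries_def space_null_model abs_le_iff PiE_iff)
  qed (use \<tau> \<tau>_ge in \<open>simp_all del: power_Suc\<close>)
  ultimately show "real (card {A \<in> \<A>. \<tau> < \<bar>(\<integral>z. q z \<partial>null_model p) - (\<integral>z. q z \<partial>planted_model p A)\<bar>}) \<le> 4 / \<tau>\<^sup>2"
    by simp
qed

end

section \<open>The lower bound\<close>

theorem theorem4p4:
  "\<exists>C1 C2 C3 C4 c1 c2 c3 :: real.
     C1 > 0 \<and> C2 > 0 \<and> C3 > 0 \<and> C4 > 0 \<and> c1 > 0 \<and> c2 > 0 \<and> c3 > 0 \<and>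
     (\<forall>(eps::real) (\<delta>::real) (p::nat) (k::nat) (\<tau>::real) (M :: sq_strategy measure).
        0 < eps \<and> eps < 1/2 \<and>
        \<delta> > 0 \<and> eps / \<delta> \<ge> C1 \<and>
        p \<ge> 3 \<and> real p \<ge> C2 * ((eps / \<delta>) * ln (real p)) powr C3 \<and>
        0 < \<tau> \<and> \<tau> < 1 \<and>
        solves_regression p eps \<delta> k \<tau> M \<longrightarrow>
          real k \<ge> 2 powr (c1 * real p powr c2) \<or>
          \<tau> \<le> C4 * real p powr (- c3 * eps\<^sup>2 / \<delta>\<^sup>2))"
proof -
  \<comment> \<open>The threshold 288 = 16 * 18 makes T at least 16, so that d is positive and
    \<open>mT\<close> holds. The factor 2^96 = 16^24 is chosen for taking sixth roots.\<close>
  have main: "2 powr (1 / 4 * real p powr (1 / 6)) \<le> real k"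
    if eps: "0 < eps" "eps < 1 / 2" and \<delta>: "0 < \<delta>" and C1: "288 \<le> eps / \<delta>" and p: "3 \<le> p"
      and C2: "2 ^ 96 * ((eps / \<delta>) * ln (real p)) powr 24 \<le> real p"
      and \<tau>: "0 < \<tau>" and sol: "solves_regression p eps \<delta> k \<tau> M"
      and big: "5 * real p powr (- (1 / 2000000) * eps\<^sup>2 / \<delta>\<^sup>2) < \<tau>"
    for eps \<delta> \<tau> :: real and p k :: nat and M :: "sq_strategy measure"
  proof -
    define E where "E = eps / \<delta>"
    define T where "T = E / 18"
    define d where "d = nat \<lfloor>T\<^sup>2 / 256\<rfloor>"
    define a where "a = real p powr (1 / 6)"
    define t where "t = nat \<lfloor>a\<rfloor>"
    have E: "288 \<le> E" using C1 by (simp add: E_def)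
    have T: "16 \<le> T" using E by (simp add: T_def)
    have T2: "256 \<le> T\<^sup>2" using power_mono[OF T, of 2] by simp
    have d: "real d \<le> T\<^sup>2 / 256" "T\<^sup>2 / 256 < real (Suc d)"
      unfolding d_def using T2 by linarith+
    \<comment> \<open>The length 3 \<delta> leaves room above the separation 2 \<delta>, and then T
      = eps / (18 \<delta>) is forced by \<open>6 * \<kappa> * T = eps\<close>. The number of
      moments is even because the Taylor argument is quadratic.\<close>
    interpret hidden_shift eps T "3 * \<delta>" "2 * d"
    proof
      show "6 * (3 * \<delta>) * T = eps" using \<delta> by (simp add: T_def E_def)
      show "64 * (real (2 * d) + 1) \<le> T\<^sup>2" using d T2 by simp
    qed (use eps T in auto)
    have a: "0 < a" "a ^ 6 = real p"
      using p by (simp_all add: a_def powr_power)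
    \<comment> \<open>This makes p^(1/6) far larger than E^2, hence than the number d + 1 of
      correlation factors, and large enough to swallow the numerical constants.\<close>
    have a_ge: "(16 * E) ^ 4 \<le> a"
    proof (rule power_le_imp_le_base[of _ 5])
      have "exp 1 \<le> real p" using exp_le p by linarith
      then have "1 \<le> ln (real p)" using p by (subst ln_ge_iff) auto
      then have "E * 1 \<le> E * ln (real p)" using E by (intro mult_left_mono) auto
      then have "E powr 24 \<le> (E * ln (real p)) powr 24" using E by (intro powr_mono2) auto
      then have "2 ^ 96 * E powr 24 \<le> real p" using C2 by (simp add: E_def)
      moreover have "E powr 24 = E ^ 24" using E powr_realpow[of E 24] by simp
      ultimately have "(16 * E) ^ 24 \<le> real p" by (simp add: power_mult_distrib)
      then show "((16 * E) ^ 4) ^ Suc 5 \<le> a ^ Suc 5" using a by (simp flip: power_mult)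
    qed (use a in simp)
    have E2: "2 ^ 16 \<le> E\<^sup>2"
      using power_mono[OF E, of 2] by simp
    have E4: "2 ^ 32 * E\<^sup>2 \<le> a"
    proof -
      have "2 ^ 16 * E\<^sup>2 \<le> E\<^sup>2 * E\<^sup>2" using E2 by (intro mult_right_mono) auto
      also have "\<dots> = E ^ 4" by (simp flip: power_add)
      finally show ?thesis using a_ge by (simp add: power_mult_distrib)
    qed
    have t: "real t \<le> a" "a < real t + 1"
      unfolding t_def using a by linarith+
    have a48: "2 ^ 48 \<le> a" using E2 E4 by simp
    have t_ge: "a / 2 \<le> real t" "256 \<le> t"
    proof -
      show "a / 2 \<le> real t" using t a48 by simp
      have "256 \<le> real t" using t a48 by simp
      then show "256 \<le> t" by simp
    qed
    have N: "real (Suc d) \<le> E\<^sup>2" using d(1) E2 by (simp add: T_def power_divide)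
    have N2: "2 * Suc d \<le> t"
    proof -
      have "4 * E\<^sup>2 \<le> 2 ^ 32 * E\<^sup>2" by (intro mult_right_mono) auto
      then have "4 * E\<^sup>2 \<le> a" using E4 by (rule order_trans)
      then have "2 * E\<^sup>2 \<le> a / 2" by simp
      then have "2 * real (Suc d) \<le> real t"
        using mult_left_mono[OF N, of 2] t_ge(1) by (meson order_trans zero_le_numeral)
      then have "real (2 * Suc d) \<le> real t" by (simp only: of_nat_mult of_nat_numeral)
      then show ?thesis by (simp only: of_nat_le_iff)
    qed
    \<comment> \<open>The decay base is 256 / t with t about a. Giving up half the exponent of a
      absorbs the 256, so the base is at most 1 / b with b = p^(1/12).\<close>
    define b where "b = sqrt a"
    have b: "0 < b" "b\<^sup>2 = a" using a by (auto simp: b_def)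
    have b512: "512 \<le> b" unfolding b_def using a48 by (intro real_le_rsqrt) simp
    have "b * 512 \<le> b * b" using b512 b by (intro mult_left_mono) auto
    then have "b * 512 \<le> a" unfolding b(2)[symmetric] power2_eq_square .
    then have bt: "256 * b \<le> real t" using t_ge(1) by simp
    have small: "24 * (256 * (real t / real (t\<^sup>2))) ^ Suc d \<le> \<tau>\<^sup>2" and \<tau>_ge: "25 * (1 / b) ^ Suc d \<le> \<tau>\<^sup>2"
    proof -
      have b_pow: "b powr (- real (Suc d)) = (1 / b) ^ Suc d"
        using b by (simp only: powr_minus powr_realpow power_one_over inverse_eq_divide)
      have p_b: "real p = b powr 12"
      proof -
        have "b powr 12 = b ^ (2 * 6)" using b(1) powr_realpow[of b 12] by simp
        also have "\<dots> = real p" unfolding power_mult b(2) a(2) ..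
        finally show ?thesis by simp
      qed
      have E_sq: "eps\<^sup>2 / \<delta>\<^sup>2 = E\<^sup>2" by (simp add: E_def power_divide)
      \<comment> \<open>Since d + 1 exceeds T^2 / 256 = E^2 / 82944, the value c3 = 1 / 2000000
        suffices: squaring the tolerance and rewriting p = b^12 multiplies it by 24, and 24 /
        2000000 is just below 1 / 82944.\<close>
      have "12 * E\<^sup>2 / 1000000 \<le> real (Suc d)"
      proof -
        have "T\<^sup>2 = E\<^sup>2 / 324" by (simp add: T_def power_divide)
        then show ?thesis using d(2) zero_le_power2[of E] by linarith
      qed
      then have "b powr (- real (Suc d)) \<le> b powr (- (12 * E\<^sup>2 / 1000000))"
        using b512 by (intro powr_mono) auto
      also have "\<dots> = (real p powr (- (1 / 2000000) * eps\<^sup>2 / \<delta>\<^sup>2))\<^sup>2"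
      proof -
        let ?c = "- (1 / 2000000) * eps\<^sup>2 / \<delta>\<^sup>2"
        have "12 * (?c + ?c) = - (12 * E\<^sup>2 / 1000000)" unfolding E_sq[symmetric] by simp
        moreover have "(real p powr ?c)\<^sup>2 = b powr (12 * (?c + ?c))"
          by (simp only: p_b power2_eq_square[of "_ powr _"] powr_add powr_powr distrib_left)
        ultimately show ?thesis by (simp only:)
      qed
      finally have "25 * (1 / b) ^ Suc d \<le> (5 * real p powr (- (1 / 2000000) * eps\<^sup>2 / \<delta>\<^sup>2))\<^sup>2"
        unfolding b_pow by (simp add: power_mult_distrib)
      also have "\<dots> \<le> \<tau>\<^sup>2" using big by (intro power_mono) auto
      finally show *: "25 * (1 / b) ^ Suc d \<le> \<tau>\<^sup>2" .
      have "256 * (real t / real (t\<^sup>2)) \<le> 1 / b"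
        using bt t_ge(2) b by (simp add: power2_eq_square field_simps)
      then have "24 * (256 * (real t / real (t\<^sup>2))) ^ Suc d \<le> 24 * (1 / b) ^ Suc d"
        by (intro mult_left_mono power_mono) auto
      also have "\<dots> \<le> 25 * (1 / b) ^ Suc d" using b by (intro mult_right_mono) auto
      finally show "24 * (256 * (real t / real (t\<^sup>2))) ^ Suc d \<le> \<tau>\<^sup>2" using * by (rule order_trans)
    qed
    have "real t ^ 6 \<le> real p" using t unfolding a(2)[symmetric] by (intro power_mono) auto
    then have "t ^ 6 \<le> p" by (simp flip: of_nat_power)
    then obtain \<A> where \<A>: "\<A> \<subseteq> {A. A \<subseteq> {..<p} \<and> card A = t\<^sup>2}"
      "\<And>A B. A \<in> \<A> \<Longrightarrow> B \<in> \<A> \<Longrightarrow> A \<noteq> B \<Longrightarrow> card (A \<inter> B) < t" "t ^ t \<le> card \<A>"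
      using many_nearly_disjoint_subsets[of t p] t_ge(2) by auto
    have "0.9 * real (card \<A>) \<le> 1 + real k * (4 / \<tau>\<^sup>2)"
      using t_ge(2) \<delta>
      by (intro regression_query_lower_bound[OF sol _ \<tau> refl _ _ \<A>(1,2) small]) (auto simp: power2_eq_square)
    then have "0.9 * real (card \<A>) \<le> 1 + 4 * (real k / \<tau>\<^sup>2)" by simp
    moreover have card: "real t ^ t \<le> real (card \<A>)" using \<A>(3) by (simp flip: of_nat_power)
    moreover have "2 \<le> real t ^ t"
    proof -
      have "2 \<le> real t ^ 1" using t_ge(2) by simp
      also have "\<dots> \<le> real t ^ t" using t_ge(2) by (intro power_increasing) auto
      finally show ?thesis .
    qed
    \<comment> \<open>The family has at least two members, so the additive 1 is at most half its
      size; 0.4 of the size then remains against 4 k / \<tau>^2.\<close>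
    ultimately have "real (card \<A>) \<le> 10 * (real k / \<tau>\<^sup>2)" by argo
    then have "real (card \<A>) * \<tau>\<^sup>2 \<le> 10 * real k" using \<tau> by (simp add: pos_le_divide_eq)
    moreover have "real t ^ t * (25 * (1 / b) ^ Suc d) \<le> real (card \<A>) * \<tau>\<^sup>2"
      using card \<tau>_ge b by (intro mult_mono) auto
    \<comment> \<open>The tolerance costs b^(d + 1), less than t^(d + 1). As t is at least 2 (d +
      1), at least half of the exponent of t^t survives.\<close>
    moreover have "real t ^ (t - Suc d) \<le> real t ^ t * (1 / b) ^ Suc d"
    proof -
      have "real t ^ (t - Suc d) = real t ^ t * (1 / real t) ^ Suc d"
        using N2 t_ge(2) by (simp add: power_diff power_one_over del: power_Suc)
      also have "\<dots> \<le> real t ^ t * (1 / b) ^ Suc d"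
        using bt b by (intro mult_left_mono power_mono frac_le) auto
      finally show ?thesis .
    qed
    moreover have "2 powr (1 / 4 * a) \<le> real t ^ (t - Suc d)"
    proof -
      have "real t \<le> real (2 * (t - Suc d))" using N2 by (intro of_nat_mono) simp
      then have "1 / 4 * a \<le> real (t - Suc d)" using t_ge(1) by simp
      then have "2 powr (1 / 4 * a) \<le> 2 powr (real (t - Suc d))" by (intro powr_mono) auto
      also have "\<dots> = 2 ^ (t - Suc d)" by (simp add: powr_realpow)
      also have "\<dots> \<le> real t ^ (t - Suc d)" using t_ge(2) by (intro power_mono) auto
      finally show ?thesis .
    qed
    moreover have "0 \<le> real t ^ t * (1 / b) ^ Suc d" using b by simp
    \<comment> \<open>The factor 25 = 5^2 coming from C4 = 5 outweighs the 10 in front of k.\<close>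
    ultimately have "2 powr (1 / 4 * a) \<le> real k" by linarith
    then show ?thesis by (simp add: a_def)
  qed
  show ?thesis
  proof (intro exI conjI allI impI; (elim conjE)?)
    fix eps \<delta> \<tau> :: real and p k :: nat and M :: "sq_strategy measure"
    assume h: "0 < eps" "eps < 1 / 2" "0 < \<delta>" "288 \<le> eps / \<delta>" "3 \<le> p"
      "2 ^ 96 * ((eps / \<delta>) * ln (real p)) powr 24 \<le> real p" "0 < \<tau>" "\<tau> < 1" "solves_regression p eps \<delta> k \<tau> M"
    show "real k \<ge> 2 powr (1 / 4 * real p powr (1 / 6)) \<or>
          \<tau> \<le> 5 * real p powr (- (1 / 2000000) * eps\<^sup>2 / \<delta>\<^sup>2)"
      using main[OF h(1-7,9)] by (meson not_less)
  qed simp_all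
qed

end
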